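(* (Chern correspondence) Let $(E,L)$ be a pair given by a complex string algebroid $E$ over $X$ and a lifting $L\subset E$ of $T^{0,1}X$. Then any compact form $E_{\mathbb R}\subset E$ determines uniquely a horizontal lift $W\subset E_{\mathbb R}$ such that $$L=\{e\in W\otimes\mathbb C\;|\;\pi(e)\in T^{0,1}X\}\subset E.$$
   Context: $X$ is a complex manifold with underlying smooth manifold $\underline X$. $G$ is a complex reductive Lie group with maximal compact subgroup $K$, and $\langle,\rangle$ is an invariant non-degenerate symmetric $\mathbb C$-bilinear form on $\mathfrak g$ which is real-valued on $\mathfrak k$. **Courant algebroids.** A smooth complex Courant algebroid over $X$ is a smooth complex vector bundle $E$ with a non-degenerate symmetric bilinear form $\langle,\rangle$, a bundle map (anchor) $\pi:E\to T\underline X\otimes\mathbb C$ and a bracket $[,]$ on smooth sections such that, for sections $u,v,w$ and functions $\phi$: $[u,[v,w]]=[[u,v],w]+[v,[u,w]]$; $\pi([u,v])=[\pi(u),\pi(v)]$; $[u,\phi v]=\pi(u)(\phi)v+\phi[u,v]$; $\pi(u)\langle v,w\rangle=\langle[u,v],w\rangle+\langle v,[u,w]\rangle$; $[u,v]+[v,u]=\mathcal D\langle u,v\rangle$, where $\mathcal D\phi$ is the image of $d\phi$ under $\pi^*$ and the isomorphism $E^*\cong E$ given by the pairing. A smooth real Courant algebroid over $\underline X$ is defined in the same way with a real bundle and anchor to $T\underline X$. **Complex string algebroid.** $(E,\underline P,\rho_c)$: $\underline P$ is a smooth principal $G$-bundle; $E$ is a smooth complex Courant algebroid; $\rho_c:E\to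 A_{\underline P}$ is bracket-preserving with $0\to T^*\underline X\otimes\mathbb C\to E\to A_{\underline P}\to0$ exact, such that the induced map $E/(\ker\pi)^\perp\to A_{\underline P}$ is an isomorphism of Lie algebroids restricting to an isometry $\ker\pi/(\ker\pi)^\perp\cong(\operatorname{ad}\underline P,\langle,\rangle)$. Here $A_{\underline P}$ is the complex Atiyah algebroid, $0\to\operatorname{ad}\underline P\to A_{\underline P}\to T\underline X\otimes\mathbb C\to0$, i.e. the quotient of the complexification of $T\underline P/G$ by the ideal $(\operatorname{ad}\underline P)^{0,1}$. **Lifting.** A lifting of $T^{0,1}X$ to $E$ is an isotropic, involutive subbundle $L\subset E$ mapping isomorphically onto $T^{0,1}X$ under $\pi$. **Compact form.** A real string algebroid $(E_{\mathbb R},P_{\mathbb R},\rho_{\mathbb R})$ with structure group $K$: $P_{\mathbb R}$ is a smooth principal $K$-bundle, $E_{\mathbb R}$ a smooth real Courant algebroid, and $\rho_{\mathbb R}:E_{\mathbb R}\to A_{P_{\mathbb R}}=TP_{\mathbb R}/K$ satisfies the analogous conditions with $0\to T^*\underline X\to E_{\mathbb R}\to A_{P_{\mathbb R}}\to0$ exact and $\ker\pi/(\ker\pi)^\perp\cong(\operatorname{ad}P_{\mathbb R},\langle,\rangle)$. A compact form of $E$ is a real string algebroid $E_{\mathbb R}\subset E$ with structure group $K$, with $P_{\mathbb R}\subset\underline P$ a reduction to $K$, such that the inclusion is compatible with $T^*\underline X\subset T^*\underline X\otimes\mathbb C$ and with the canonical injection $A_{P_{\mathbb R}}\to A_{\underline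 P}$, and the $\mathbb C$-linear extension of the bracket, pairing and $\rho_{\mathbb R}$ identifies $E_{\mathbb R}\otimes\mathbb C$ with $E$. **Horizontal lift.** A horizontal lift of $T\underline X$ to $E_{\mathbb R}$ is a subbundle $W\subset E_{\mathbb R}$ with $\operatorname{rk}W=\dim_{\mathbb R}\underline X$ and $W\cap\ker\pi=\{0\}$. *)

theory Defs
  imports "HOL-Analysis.Analysis" "HOL-Algebra.Group" "HOL-Library.Function_Algebras"
begin

section \<open>Smooth and complex manifolds\<close>

primrec Ck_on :: "nat \<Rightarrow> 'a::real_normed_vector set \<Rightarrow> ('a \<Rightarrow> 'b::real_normed_vector) \<Rightarrow> bool" where
  "Ck_on 0 S f \<longleftrightarrow> continuous_on S f"
| "Ck_on (Suc k) S f \<longleftrightarrow> (\<forall>x\<in>S. f differentiable (at x)) \<and>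
     (\<forall>v. Ck_on k S (\<lambda>x. frechet_derivative f (at x) v))"

text \<open>Smoothness on an arbitrary set means local extendability to a smooth function on an open
  set. It is only used for relatively open subsets of linear subspaces.\<close>

definition smooth_on :: "'a::real_normed_vector set \<Rightarrow> ('a \<Rightarrow> 'b::real_normed_vector) \<Rightarrow> bool" where
  "smooth_on S f \<longleftrightarrow> (\<forall>x\<in>S. \<exists>U g. open U \<and> x \<in> U \<and> (\<forall>k. Ck_on k U g) \<and> (\<forall>y\<in>S \<inter> U. g y = f y))"

text \<open>Charts take values in open subsets of a linear subspace (the model space), so that the
  dimension is the dimension of that subspace and may be zero.\<close>

record ('m, 'a) manifold =
  mtop :: "'m topology"
  mmodel :: "'a set"
  atlas :: "('m set \<times> ('m \<Rightarrow> 'a)) set"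

abbreviation mcarrier :: "('m, 'a) manifold \<Rightarrow> 'm set" where
  "mcarrier M \<equiv> topspace (mtop M)"

definition smooth_manifold :: "('m, 'a::euclidean_space) manifold \<Rightarrow> bool" where
  "smooth_manifold M \<longleftrightarrow>
     Hausdorff_space (mtop M) \<and> second_countable (mtop M) \<and> subspace (mmodel M) \<and>
     (\<Union>(U, \<phi>)\<in>atlas M. U) = mcarrier M \<and>
     (\<forall>(U, \<phi>)\<in>atlas M. openin (mtop M) U \<and> openin (top_of_set (mmodel M)) (\<phi> ` U) \<and>
        homeomorphic_map (subtopology (mtop M) U) (top_of_set (\<phi> ` U)) \<phi>) \<and>
     (\<forall>(U, \<phi>)\<in>atlas M. \<forall>(V, \<psi>)\<in>atlas M. smooth_on (\<phi> ` (U \<inter> V)) (\<psi> \<circ> inv_into U \<phi>))"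

definition smooth_fun :: "('m, 'a::euclidean_space) manifold \<Rightarrow> 'm set \<Rightarrow> ('m \<Rightarrow> 'b::real_normed_vector) \<Rightarrow> bool" where
  "smooth_fun M S f \<longleftrightarrow> (\<forall>(U, \<phi>)\<in>atlas M. smooth_on (\<phi> ` (U \<inter> S)) (f \<circ> inv_into U \<phi>))"

definition smooth_near :: "('m, 'a::euclidean_space) manifold \<Rightarrow> 'm \<Rightarrow> ('m \<Rightarrow> 'b::real_normed_vector) \<Rightarrow> bool" where
  "smooth_near M x f \<longleftrightarrow> (\<exists>S. openin (mtop M) S \<and> x \<in> S \<and> smooth_fun M S f)"

definition smooth_map_on :: "('m, 'a::euclidean_space) manifold \<Rightarrow> 'm set \<Rightarrow> ('n, 'b::euclidean_space) manifold \<Rightarrow> ('m \<Rightarrow> 'n) \<Rightarrow> bool" where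
  "smooth_map_on M S N F \<longleftrightarrow>
     continuous_map (subtopology (mtop M) S) (mtop N) F \<and>
     (\<forall>(U, \<phi>)\<in>atlas M. \<forall>(V, \<psi>)\<in>atlas N.
        smooth_on (\<phi> ` {x \<in> U \<inter> S. F x \<in> V}) (\<psi> \<circ> F \<circ> inv_into U \<phi>))"

abbreviation smooth_map :: "('m, 'a::euclidean_space) manifold \<Rightarrow> ('n, 'b::euclidean_space) manifold \<Rightarrow> ('m \<Rightarrow> 'n) \<Rightarrow> bool" where
  "smooth_map M \<equiv> smooth_map_on M (mcarrier M)"

definition prod_manifold :: "('m, 'a) manifold \<Rightarrow> ('n, 'b) manifold \<Rightarrow> ('m \<times> 'n, 'a \<times> 'b) manifold" where
  "prod_manifold M N =
     \<lparr>mtop = prod_topology (mtop M) (mtop N), mmodel = mmodel M \<times> mmodel N,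
      atlas = {(U \<times> V, map_prod \<phi> \<psi>) | U \<phi> V \<psi>. (U, \<phi>) \<in> atlas M \<and> (V, \<psi>) \<in> atlas N}\<rparr>"

definition real_line :: "(real, real) manifold" where
  "real_line = \<lparr>mtop = euclidean, mmodel = UNIV, atlas = {(UNIV, \<lambda>t. t)}\<rparr>"

text \<open>\<open>J\<close> is multiplication by the imaginary unit on the model space, which is thereby a
  finite-dimensional complex vector space; holomorphic means smooth with complex-linear derivative.\<close>

definition holo_on :: "('a::euclidean_space \<Rightarrow> 'a) \<Rightarrow> 'a set \<Rightarrow> ('b::euclidean_space \<Rightarrow> 'b) \<Rightarrow> 'a set \<Rightarrow> ('a \<Rightarrow> 'b) \<Rightarrow> bool" where
  "holo_on J V J' S f \<longleftrightarrow> smooth_on S f \<and>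
     (\<forall>y\<in>S. \<exists>D. (f has_derivative D) (at y within S) \<and> (\<forall>v\<in>V. D (J v) = J' (D v)))"

definition complex_manifold :: "('m, 'a::euclidean_space) manifold \<Rightarrow> ('a \<Rightarrow> 'a) \<Rightarrow> bool" where
  "complex_manifold M J \<longleftrightarrow>
     smooth_manifold M \<and> linear J \<and> (\<forall>v\<in>mmodel M. J v \<in> mmodel M \<and> J (J v) = - v) \<and>
     (\<forall>(U, \<phi>)\<in>atlas M. \<forall>(V, \<psi>)\<in>atlas M.
        holo_on J (mmodel M) J (\<phi> ` (U \<inter> V)) (\<psi> \<circ> inv_into U \<phi>))"

definition holomorphic_map :: "('m, 'a::euclidean_space) manifold \<Rightarrow> ('a \<Rightarrow> 'a) \<Rightarrow> ('n, 'b::euclidean_space) manifold \<Rightarrow> ('b \<Rightarrow> 'b) \<Rightarrow> ('m \<Rightarrow> 'n) \<Rightarrow> bool" where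
  "holomorphic_map M J N J' F \<longleftrightarrow>
     continuous_map (mtop M) (mtop N) F \<and>
     (\<forall>(U, \<phi>)\<in>atlas M. \<forall>(V, \<psi>)\<in>atlas N.
        holo_on J (mmodel M) J' (\<phi> ` {x \<in> U. F x \<in> V}) (\<psi> \<circ> F \<circ> inv_into U \<phi>))"


section \<open>Tangent vectors\<close>

text \<open>A tangent vector is the velocity of a smooth curve, viewed as a functional on functions that
  are smooth near the base point (and set to zero on all other functions). The functions take
  values in \<open>'k\<close>; for \<open>'k = real\<close> the space below is the tangent space, for \<open>'k = complex\<close> it is its
  complexification.\<close>

type_synonym ('m, 'k) tvec = "('m \<Rightarrow> 'k) \<Rightarrow> 'k"

definition velocity :: "('m, 'a::euclidean_space) manifold \<Rightarrow> (real \<Rightarrow> 'm) \<Rightarrow> ('m, 'k::real_normed_field) tvec" where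
  "velocity M \<gamma> = (\<lambda>f. if smooth_near M (\<gamma> 0) f then vector_derivative (\<lambda>t. f (\<gamma> t)) (at 0) else 0)"

definition tscale :: "'k::real_normed_field \<Rightarrow> ('m, 'k) tvec \<Rightarrow> ('m, 'k) tvec" where
  "tscale c v = (\<lambda>f. c * v f)"

definition tangent_space :: "('m, 'a::euclidean_space) manifold \<Rightarrow> 'm \<Rightarrow> ('m, 'k::real_normed_field) tvec set" where
  "tangent_space M x = module.span tscale
     {velocity M \<gamma> | \<gamma>. \<gamma> 0 = x \<and> (\<exists>I. open I \<and> 0 \<in> I \<and> smooth_map_on real_line I M \<gamma>)}"

definition cplx :: "('m, 'a::euclidean_space) manifold \<Rightarrow> 'm \<Rightarrow> ('m, real) tvec \<Rightarrow> ('m, complex) tvec" where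
  "cplx M x u = (\<lambda>f. if smooth_near M x f then Complex (u (\<lambda>y. Re (f y))) (u (\<lambda>y. Im (f y))) else 0)"

text \<open>The differential at \<open>x\<close> of a smooth map \<open>F\<close> from some manifold to \<open>N\<close>.\<close>

definition push :: "('n, 'b::euclidean_space) manifold \<Rightarrow> ('m \<Rightarrow> 'n) \<Rightarrow> 'm \<Rightarrow> ('m, 'k::real_normed_field) tvec \<Rightarrow> ('n, 'k) tvec" where
  "push N F x v = (\<lambda>f. if smooth_near N (F x) f then v (\<lambda>y. f (F y)) else 0)"

definition chart_coords :: "('m \<Rightarrow> 'a::euclidean_space) \<Rightarrow> ('m, real) tvec \<Rightarrow> 'a" where
  "chart_coords \<phi> u = (\<Sum>b\<in>Basis. u (\<lambda>y. \<phi> y \<bullet> b) *\<^sub>R b)"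

definition tangent_J :: "('m, 'a::euclidean_space) manifold \<Rightarrow> ('a \<Rightarrow> 'a) \<Rightarrow> 'm \<Rightarrow> ('m, real) tvec \<Rightarrow> ('m, real) tvec" where
  "tangent_J M J x u = (THE w. w \<in> tangent_space M x \<and>
     (\<forall>(U, \<phi>)\<in>atlas M. x \<in> U \<longrightarrow> chart_coords \<phi> w = J (chart_coords \<phi> u)))"

text \<open>The eigenspace of the complexified \<open>J\<close> for the eigenvalue \<open>- \<i>\<close>: for \<open>v = u + \<i> w\<close> with real
  \<open>u\<close> and \<open>w\<close>, the equation \<open>J v = - \<i> v\<close> says \<open>J u = w\<close> and \<open>J w = - u\<close>.\<close>

definition T01 :: "('m, 'a::euclidean_space) manifold \<Rightarrow> ('a \<Rightarrow> 'a) \<Rightarrow> 'm \<Rightarrow> ('m, complex) tvec set" where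
  "T01 M J x = {cplx M x u + tscale \<i> (cplx M x w) | u w.
     u \<in> tangent_space M x \<and> w \<in> tangent_space M x \<and>
     tangent_J M J x u = w \<and> tangent_J M J x w = - u}"

definition cotangent_space :: "('m, 'a::euclidean_space) manifold \<Rightarrow> 'm \<Rightarrow> (('m, 'k::real_normed_field) tvec \<Rightarrow> 'k) set" where
  "cotangent_space M x = {\<alpha>.
     (\<forall>s\<in>tangent_space M x. \<forall>t\<in>tangent_space M x. \<alpha> (s + t) = \<alpha> s + \<alpha> t) \<and>
     (\<forall>c. \<forall>t\<in>tangent_space M x. \<alpha> (tscale c t) = c * \<alpha> t) \<and>
     (\<forall>t. t \<notin> tangent_space M x \<longrightarrow> \<alpha> t = 0)}"

definition differential :: "('m, 'a::euclidean_space) manifold \<Rightarrow> 'm \<Rightarrow> ('m \<Rightarrow> 'k::real_normed_field) \<Rightarrow> ('m, 'k) tvec \<Rightarrow> 'k" where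
  "differential M x f = (\<lambda>t. if t \<in> tangent_space M x then t f else 0)"

definition smooth_vfield :: "('m, 'a::euclidean_space) manifold \<Rightarrow> 'm set \<Rightarrow> ('m \<Rightarrow> ('m, 'k::real_normed_field) tvec) \<Rightarrow> bool" where
  "smooth_vfield M S A \<longleftrightarrow> (\<forall>p\<in>S. A p \<in> tangent_space M p) \<and>
     (\<forall>U f. openin (mtop M) U \<and> U \<subseteq> S \<and> smooth_fun M U f \<longrightarrow> smooth_fun M U (\<lambda>p. A p f))"

definition lie_bracket :: "('m, 'a::euclidean_space) manifold \<Rightarrow> ('m \<Rightarrow> ('m, 'k::real_normed_field) tvec) \<Rightarrow> ('m \<Rightarrow> ('m, 'k) tvec) \<Rightarrow> 'm \<Rightarrow> ('m, 'k) tvec" where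
  "lie_bracket M A B p = (\<lambda>f. if smooth_near M p f
     then A p (\<lambda>y. B y f) - B p (\<lambda>y. A y f) else 0)"


section \<open>Lie groups\<close>

definition lie_group :: "'g monoid \<Rightarrow> ('g, 'h::euclidean_space) manifold \<Rightarrow> bool" where
  "lie_group G GM \<longleftrightarrow> group G \<and> smooth_manifold GM \<and> mcarrier GM = carrier G \<and>
     smooth_map (prod_manifold GM GM) GM (\<lambda>(a, b). a \<otimes>\<^bsub>G\<^esub> b) \<and>
     smooth_map GM GM (\<lambda>a. inv\<^bsub>G\<^esub> a)"

definition complex_lie_group :: "'g monoid \<Rightarrow> ('g, 'h::euclidean_space) manifold \<Rightarrow> ('h \<Rightarrow> 'h) \<Rightarrow> bool" where
  "complex_lie_group G GM J \<longleftrightarrow> lie_group G GM \<and> complex_manifold GM J \<and>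
     holomorphic_map (prod_manifold GM GM) (map_prod J J) GM J (\<lambda>(a, b). a \<otimes>\<^bsub>G\<^esub> b) \<and>
     holomorphic_map GM J GM J (\<lambda>a. inv\<^bsub>G\<^esub> a)"

definition maximal_compact_subgroup :: "'g monoid \<Rightarrow> ('g, 'h) manifold \<Rightarrow> 'g set \<Rightarrow> bool" where
  "maximal_compact_subgroup G GM K \<longleftrightarrow> subgroup K G \<and> compactin (mtop GM) K \<and>
     (\<forall>H. subgroup H G \<and> compactin (mtop GM) H \<and> K \<subseteq> H \<longrightarrow> H = K)"

text \<open>The Lie group structure of a closed subgroup \<open>K\<close> inducing the subspace topology; by the closed
  subgroup theorem it exists and is unique up to the choice of the atlas.\<close>

definition closed_lie_subgroup :: "'g monoid \<Rightarrow> ('g, 'h::euclidean_space) manifold \<Rightarrow> 'g set \<Rightarrow> ('g, 'l::euclidean_space) manifold \<Rightarrow> bool" where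
  "closed_lie_subgroup G GM K KM \<longleftrightarrow> subgroup K G \<and> closedin (mtop GM) K \<and>
     lie_group (G\<lparr>carrier := K\<rparr>) KM \<and> mtop KM = subtopology (mtop GM) K \<and> smooth_map KM GM (\<lambda>k. k)"

abbreviation lie_alg :: "'g monoid \<Rightarrow> ('g, 'h::euclidean_space) manifold \<Rightarrow> ('g, real) tvec set" where
  "lie_alg G GM \<equiv> tangent_space GM \<one>\<^bsub>G\<^esub>"

text \<open>A complex reductive group is a complex Lie group which is the complexification of its maximal
  compact subgroup: it has finitely many components (hence as many as \<open>K\<close>), and its Lie algebra is
  the direct sum of that of \<open>K\<close> and \<open>\<i>\<close> times it.\<close>

definition complex_reductive :: "'g monoid \<Rightarrow> ('g, 'h::euclidean_space) manifold \<Rightarrow> ('h \<Rightarrow> 'h) \<Rightarrow> 'g set \<Rightarrow> ('g, 'l::euclidean_space) manifold \<Rightarrow> bool" where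
  "complex_reductive G GM J K KM \<longleftrightarrow>
     complex_lie_group G GM J \<and> finite (connected_components_of (mtop GM)) \<and>
     maximal_compact_subgroup G GM K \<and> closed_lie_subgroup G GM K KM \<and>
     (\<forall>\<xi>\<in>lie_alg G GM. \<exists>!(a, b). a \<in> lie_alg G KM \<and> b \<in> lie_alg G KM \<and>
        \<xi> = push GM (\<lambda>k. k) \<one>\<^bsub>G\<^esub> a + tangent_J GM J \<one>\<^bsub>G\<^esub> (push GM (\<lambda>k. k) \<one>\<^bsub>G\<^esub> b))"

text \<open>The Lie algebra of \<open>G\<close> is its real tangent space at the identity, with complex structure
  \<^const>\<open>tangent_J\<close>.\<close>

definition invariant_form :: "'g monoid \<Rightarrow> ('g, 'h::euclidean_space) manifold \<Rightarrow> ('h \<Rightarrow> 'h) \<Rightarrow> (('g, real) tvec \<Rightarrow> ('g, real) tvec \<Rightarrow> complex) \<Rightarrow> bool" where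
  "invariant_form G GM J B \<longleftrightarrow>
     (\<forall>\<xi>\<in>lie_alg G GM. \<forall>\<eta>\<in>lie_alg G GM. B \<xi> \<eta> = B \<eta> \<xi>) \<and>
     (\<forall>\<xi>\<in>lie_alg G GM. \<forall>\<eta>\<in>lie_alg G GM. \<forall>\<zeta>\<in>lie_alg G GM. B (\<xi> + \<eta>) \<zeta> = B \<xi> \<zeta> + B \<eta> \<zeta>) \<and>
     (\<forall>c. \<forall>\<xi>\<in>lie_alg G GM. \<forall>\<eta>\<in>lie_alg G GM. B (tscale c \<xi>) \<eta> = of_real c * B \<xi> \<eta>) \<and>
     (\<forall>\<xi>\<in>lie_alg G GM. \<forall>\<eta>\<in>lie_alg G GM. B (tangent_J GM J \<one>\<^bsub>G\<^esub> \<xi>) \<eta> = \<i> * B \<xi> \<eta>) \<and>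
     (\<forall>\<xi>\<in>lie_alg G GM. (\<forall>\<eta>\<in>lie_alg G GM. B \<xi> \<eta> = 0) \<longrightarrow> \<xi> = 0) \<and>
     (\<forall>g\<in>carrier G. \<forall>\<xi>\<in>lie_alg G GM. \<forall>\<eta>\<in>lie_alg G GM.
        let Ad = push GM (\<lambda>h. g \<otimes>\<^bsub>G\<^esub> h \<otimes>\<^bsub>G\<^esub> inv\<^bsub>G\<^esub> g) \<one>\<^bsub>G\<^esub> in B (Ad \<xi>) (Ad \<eta>) = B \<xi> \<eta>)"

definition restrict_form :: "'g monoid \<Rightarrow> ('g, 'h::euclidean_space) manifold \<Rightarrow> (('g, real) tvec \<Rightarrow> ('g, real) tvec \<Rightarrow> complex) \<Rightarrow> ('g, real) tvec \<Rightarrow> ('g, real) tvec \<Rightarrow> complex" where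
  "restrict_form G GM B \<xi> \<eta> = B (push GM (\<lambda>k. k) \<one>\<^bsub>G\<^esub> \<xi>) (push GM (\<lambda>k. k) \<one>\<^bsub>G\<^esub> \<eta>)"

definition real_on_subgroup :: "'g monoid \<Rightarrow> ('g, 'h::euclidean_space) manifold \<Rightarrow> ('g, 'l::euclidean_space) manifold \<Rightarrow> (('g, real) tvec \<Rightarrow> ('g, real) tvec \<Rightarrow> complex) \<Rightarrow> bool" where
  "real_on_subgroup G GM KM B \<longleftrightarrow>
     (\<forall>\<xi>\<in>lie_alg G KM. \<forall>\<eta>\<in>lie_alg G KM. restrict_form G GM B \<xi> \<eta> \<in> \<real>)"


section \<open>Vector bundles\<close>

text \<open>The fibres are linear subspaces of a common vector space \<open>'v\<close>, which carries no topology and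
  serves only to express the linear structure of the fibres. The smooth structure is given by a
  collection of local frames, i.e. of local trivializations, with smooth transition matrices.\<close>

record ('x, 'v, 'k) vbundle =
  total :: "('x \<times> 'v) set"
  scal :: "'k \<Rightarrow> 'v \<Rightarrow> 'v"
  vrank :: nat
  frames :: "('x set \<times> (nat \<Rightarrow> 'x \<Rightarrow> 'v)) set"

definition smooth_section :: "('x, 'a::euclidean_space) manifold \<Rightarrow> ('x, 'v::ab_group_add, 'k::real_normed_field, 'z) vbundle_scheme \<Rightarrow> 'x set \<Rightarrow> ('x \<Rightarrow> 'v) \<Rightarrow> bool" where
  "smooth_section X B S s \<longleftrightarrow> (\<forall>x\<in>S. (x, s x) \<in> total B) \<and>
     (\<forall>(U, e)\<in>frames B. \<exists>c. (\<forall>i<vrank B. smooth_fun X (U \<inter> S) (c i)) \<and>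
        (\<forall>x\<in>U \<inter> S. s x = (\<Sum>i<vrank B. scal B (c i x) (e i x))))"

definition frame_on :: "('x, 'v::ab_group_add, 'k::real_normed_field, 'z) vbundle_scheme \<Rightarrow> ('x \<times> 'v) set \<Rightarrow> nat \<Rightarrow> 'x set \<Rightarrow> (nat \<Rightarrow> 'x \<Rightarrow> 'v) \<Rightarrow> bool" where
  "frame_on B F r U e \<longleftrightarrow> (\<forall>x\<in>U. inj_on (\<lambda>i. e i x) {..<r} \<and>
     \<not> module.dependent (scal B) ((\<lambda>i. e i x) ` {..<r}) \<and>
     module.span (scal B) ((\<lambda>i. e i x) ` {..<r}) = F `` {x})"

definition vector_bundle :: "('x, 'a::euclidean_space) manifold \<Rightarrow> ('x, 'v::ab_group_add, 'k::real_normed_field, 'z) vbundle_scheme \<Rightarrow> bool" where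
  "vector_bundle X B \<longleftrightarrow> vector_space (scal B) \<and> total B \<subseteq> mcarrier X \<times> UNIV \<and>
     (\<Union>(U, e)\<in>frames B. U) = mcarrier X \<and>
     (\<forall>(U, e)\<in>frames B. openin (mtop X) U \<and> frame_on B (total B) (vrank B) U e \<and>
        (\<forall>i<vrank B. smooth_section X B U (e i)))"

text \<open>Subbundles are given by their total space.\<close>

definition subbundle :: "('x, 'a::euclidean_space) manifold \<Rightarrow> ('x, 'v::ab_group_add, 'k::real_normed_field, 'z) vbundle_scheme \<Rightarrow> ('x \<times> 'v) set \<Rightarrow> nat \<Rightarrow> bool" where
  "subbundle X B F r \<longleftrightarrow> F \<subseteq> total B \<and>
     (\<forall>x\<in>mcarrier X. \<exists>U e. openin (mtop X) U \<and> x \<in> U \<and> frame_on B F r U e \<and>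
        (\<forall>i<r. smooth_section X B U (e i)))"

text \<open>Global sections are extended by zero outside the base, so that they are determined by their
  values on it.\<close>

definition sections :: "('x, 'a::euclidean_space) manifold \<Rightarrow> ('x, 'v::ab_group_add, 'k::real_normed_field, 'z) vbundle_scheme \<Rightarrow> ('x \<Rightarrow> 'v) set" where
  "sections X B = {s. smooth_section X B (mcarrier X) s \<and> (\<forall>x. x \<notin> mcarrier X \<longrightarrow> s x = 0)}"


section \<open>Courant algebroids\<close>

record ('x, 'v, 'k) courant = "('x, 'v, 'k) vbundle" +
  pairing :: "'x \<Rightarrow> 'v \<Rightarrow> 'v \<Rightarrow> 'k"
  anchor :: "'x \<Rightarrow> 'v \<Rightarrow> ('x, 'k) tvec"
  bracket :: "('x \<Rightarrow> 'v) \<Rightarrow> ('x \<Rightarrow> 'v) \<Rightarrow> 'x \<Rightarrow> 'v"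

text \<open>The dual of the anchor, composed with the identification of the bundle with its dual.\<close>

definition coanchor :: "('x, 'v::ab_group_add, 'k::real_normed_field) courant \<Rightarrow> 'x \<Rightarrow> (('x, 'k) tvec \<Rightarrow> 'k) \<Rightarrow> 'v" where
  "coanchor E x \<alpha> = (THE v. v \<in> total E `` {x} \<and>
     (\<forall>w\<in>total E `` {x}. pairing E x v w = \<alpha> (anchor E x w)))"

definition courant_D :: "('x, 'a::euclidean_space) manifold \<Rightarrow> ('x, 'v::ab_group_add, 'k::real_normed_field) courant \<Rightarrow> ('x \<Rightarrow> 'k) \<Rightarrow> 'x \<Rightarrow> 'v" where
  "courant_D X E f = (\<lambda>x. if x \<in> mcarrier X then coanchor E x (differential X x f) else 0)"

definition bundle_metric :: "('x, 'a::euclidean_space) manifold \<Rightarrow> ('x, 'v::ab_group_add, 'k::real_normed_field) courant \<Rightarrow> bool" where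
  "bundle_metric X E \<longleftrightarrow>
     (\<forall>x\<in>mcarrier X. \<forall>v\<in>total E `` {x}. \<forall>w\<in>total E `` {x}. pairing E x v w = pairing E x w v) \<and>
     (\<forall>x\<in>mcarrier X. \<forall>u\<in>total E `` {x}. \<forall>v\<in>total E `` {x}. \<forall>w\<in>total E `` {x}.
        pairing E x (u + v) w = pairing E x u w + pairing E x v w) \<and>
     (\<forall>x\<in>mcarrier X. \<forall>c. \<forall>v\<in>total E `` {x}. \<forall>w\<in>total E `` {x}.
        pairing E x (scal E c v) w = c * pairing E x v w) \<and>
     (\<forall>x\<in>mcarrier X. \<forall>v\<in>total E `` {x}. (\<forall>w\<in>total E `` {x}. pairing E x v w = 0) \<longrightarrow> v = 0) \<and>
     (\<forall>U u v. openin (mtop X) U \<and> smooth_section X E U u \<and> smooth_section X E U v \<longrightarrow>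
        smooth_fun X U (\<lambda>x. pairing E x (u x) (v x)))"

definition anchor_map :: "('x, 'a::euclidean_space) manifold \<Rightarrow> ('x, 'v::ab_group_add, 'k::real_normed_field) courant \<Rightarrow> bool" where
  "anchor_map X E \<longleftrightarrow>
     (\<forall>x\<in>mcarrier X. \<forall>v\<in>total E `` {x}. anchor E x v \<in> tangent_space X x) \<and>
     (\<forall>x\<in>mcarrier X. \<forall>v\<in>total E `` {x}. \<forall>w\<in>total E `` {x}.
        anchor E x (v + w) = anchor E x v + anchor E x w) \<and>
     (\<forall>x\<in>mcarrier X. \<forall>c. \<forall>v\<in>total E `` {x}. anchor E x (scal E c v) = tscale c (anchor E x v)) \<and>
     (\<forall>U u. openin (mtop X) U \<and> smooth_section X E U u \<longrightarrow>
        smooth_vfield X U (\<lambda>x. anchor E x (u x)))"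

text \<open>For \<open>'k = real\<close> these are smooth real Courant algebroids, for \<open>'k = complex\<close> smooth complex ones.
  Additivity of the bracket in both arguments follows from the axioms.\<close>

definition courant_algebroid :: "('x, 'a::euclidean_space) manifold \<Rightarrow> ('x, 'v::ab_group_add, 'k::real_normed_field) courant \<Rightarrow> bool" where
  "courant_algebroid X E \<longleftrightarrow> vector_bundle X E \<and> bundle_metric X E \<and> anchor_map X E \<and>
     (\<forall>u\<in>sections X E. \<forall>v\<in>sections X E. bracket E u v \<in> sections X E) \<and>
     (\<forall>u\<in>sections X E. \<forall>v\<in>sections X E. \<forall>w\<in>sections X E.
        bracket E u (bracket E v w) = bracket E (bracket E u v) w + bracket E v (bracket E u w)) \<and>
     (\<forall>u\<in>sections X E. \<forall>v\<in>sections X E. \<forall>x\<in>mcarrier X.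
        anchor E x (bracket E u v x) =
          lie_bracket X (\<lambda>y. anchor E y (u y)) (\<lambda>y. anchor E y (v y)) x) \<and>
     (\<forall>u\<in>sections X E. \<forall>v\<in>sections X E. \<forall>f. smooth_fun X (mcarrier X) f \<longrightarrow>
        (\<forall>x\<in>mcarrier X. bracket E u (\<lambda>y. scal E (f y) (v y)) x =
          scal E (anchor E x (u x) f) (v x) + scal E (f x) (bracket E u v x))) \<and>
     (\<forall>u\<in>sections X E. \<forall>v\<in>sections X E. \<forall>w\<in>sections X E. \<forall>x\<in>mcarrier X.
        anchor E x (u x) (\<lambda>y. pairing E y (v y) (w y)) =
          pairing E x (bracket E u v x) (w x) + pairing E x (v x) (bracket E u w x)) \<and>
     (\<forall>u\<in>sections X E. \<forall>v\<in>sections X E.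
        bracket E u v + bracket E v u = courant_D X E (\<lambda>y. pairing E y (u y) (v y)))"

definition anchor_kernel :: "('x, 'v::ab_group_add, 'k::real_normed_field) courant \<Rightarrow> 'x \<Rightarrow> 'v set" where
  "anchor_kernel E x = {v \<in> total E `` {x}. anchor E x v = 0}"

definition fibre_perp :: "('x, 'v::ab_group_add, 'k::real_normed_field) courant \<Rightarrow> 'x \<Rightarrow> 'v set \<Rightarrow> 'v set" where
  "fibre_perp E x S = {v \<in> total E `` {x}. \<forall>w\<in>S. pairing E x v w = 0}"


section \<open>Principal bundles and Atiyah algebroids\<close>

abbreviation fibre_over :: "('p, 'b) manifold \<Rightarrow> ('p \<Rightarrow> 'x) \<Rightarrow> 'x \<Rightarrow> 'p set" where
  "fibre_over P q x \<equiv> {p \<in> mcarrier P. q p = x}"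

text \<open>In the last clause \<open>\<sigma>\<close> is a local section and \<open>h\<close> the smooth inverse of the local trivialization
  \<open>(y, g) \<mapsto> \<sigma> y \<cdot> g\<close>.\<close>

definition principal_bundle :: "('x, 'a::euclidean_space) manifold \<Rightarrow> 'g monoid \<Rightarrow> ('g, 'h::euclidean_space) manifold \<Rightarrow>
    ('p, 'b::euclidean_space) manifold \<Rightarrow> ('p \<Rightarrow> 'x) \<Rightarrow> ('p \<Rightarrow> 'g \<Rightarrow> 'p) \<Rightarrow> bool" where
  "principal_bundle X G GM P q act \<longleftrightarrow>
     lie_group G GM \<and> smooth_manifold P \<and> smooth_map P X q \<and>
     smooth_map (prod_manifold P GM) P (\<lambda>(p, g). act p g) \<and>
     (\<forall>p\<in>mcarrier P. act p \<one>\<^bsub>G\<^esub> = p) \<and>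
     (\<forall>p\<in>mcarrier P. \<forall>a\<in>carrier G. \<forall>b\<in>carrier G. act p (a \<otimes>\<^bsub>G\<^esub> b) = act (act p a) b) \<and>
     (\<forall>p\<in>mcarrier P. \<forall>g\<in>carrier G. q (act p g) = q p) \<and>
     (\<forall>x\<in>mcarrier X. \<exists>U \<sigma> h. openin (mtop X) U \<and> x \<in> U \<and>
        smooth_map_on X U P \<sigma> \<and> (\<forall>y\<in>U. q (\<sigma> y) = y) \<and>
        smooth_map_on P {p \<in> mcarrier P. q p \<in> U} (prod_manifold X GM) h \<and>
        (\<forall>y\<in>U. \<forall>g\<in>carrier G. h (act (\<sigma> y) g) = (y, g)) \<and>
        (\<forall>p\<in>mcarrier P. q p \<in> U \<longrightarrow> act (\<sigma> (fst (h p))) (snd (h p)) = p))"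

text \<open>The fibre at \<open>x\<close> of \<open>TP/G\<close> (for \<open>'k = real\<close>) or of its complexification (for
  \<open>'k = complex\<close>): a \<open>G\<close>-orbit of tangent vectors at points of the fibre of \<open>P\<close> over \<open>x\<close> is the same
  as a \<open>G\<close>-equivariant tangent vector field along that fibre.\<close>

definition TP_mod_G :: "'g monoid \<Rightarrow> ('p, 'b::euclidean_space) manifold \<Rightarrow> ('p \<Rightarrow> 'x) \<Rightarrow> ('p \<Rightarrow> 'g \<Rightarrow> 'p) \<Rightarrow> 'x \<Rightarrow>
    ('p \<Rightarrow> ('p, 'k::real_normed_field) tvec) set" where
  "TP_mod_G G P q act x = {a.
     (\<forall>p\<in>fibre_over P q x. a p \<in> tangent_space P p) \<and>
     (\<forall>p. p \<notin> fibre_over P q x \<longrightarrow> a p = 0) \<and>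
     (\<forall>p\<in>fibre_over P q x. \<forall>g\<in>carrier G. a (act p g) = push P (\<lambda>p'. act p' g) p (a p))}"

definition along_fibre :: "('p, 'b) manifold \<Rightarrow> ('p \<Rightarrow> 'x) \<Rightarrow> 'x \<Rightarrow> ('p \<Rightarrow> ('p, 'k::real_normed_field) tvec) \<Rightarrow> 'p \<Rightarrow> ('p, 'k) tvec" where
  "along_fibre P q x A = (\<lambda>p. if p \<in> fibre_over P q x then A p else 0)"

text \<open>The differential of the orbit map of \<open>p\<close> identifies the Lie algebra of \<open>G\<close> with the vertical
  tangent space at \<open>p\<close>.\<close>

definition ad01 :: "'g monoid \<Rightarrow> ('g, 'h::euclidean_space) manifold \<Rightarrow> ('h \<Rightarrow> 'h) \<Rightarrow> ('p, 'b::euclidean_space) manifold \<Rightarrow>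
    ('p \<Rightarrow> 'x) \<Rightarrow> ('p \<Rightarrow> 'g \<Rightarrow> 'p) \<Rightarrow> 'x \<Rightarrow> ('p \<Rightarrow> ('p, complex) tvec) set" where
  "ad01 G GM J P q act x = {a \<in> TP_mod_G G P q act x.
     \<forall>p\<in>fibre_over P q x. a p \<in> push P (act p) \<one>\<^bsub>G\<^esub> ` T01 GM J \<one>\<^bsub>G\<^esub>}"

text \<open>The fibre at \<open>x\<close> of the complex Atiyah algebroid, as a set of cosets.\<close>

definition complex_atiyah :: "'g monoid \<Rightarrow> ('g, 'h::euclidean_space) manifold \<Rightarrow> ('h \<Rightarrow> 'h) \<Rightarrow> ('p, 'b::euclidean_space) manifold \<Rightarrow>
    ('p \<Rightarrow> 'x) \<Rightarrow> ('p \<Rightarrow> 'g \<Rightarrow> 'p) \<Rightarrow> 'x \<Rightarrow> ('p \<Rightarrow> ('p, complex) tvec) set set" where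
  "complex_atiyah G GM J P q act x =
     (\<lambda>a. (\<lambda>b. a + b) ` ad01 G GM J P q act x) ` TP_mod_G G P q act x"


section \<open>String algebroids\<close>

text \<open>The bracket on sections of \<open>A\<^sub>P\<close> is computed on invariant vector fields on \<open>P\<close> representing them.
  The final clause is the isometry condition: \<open>\<xi>\<close> and \<open>\<eta>\<close> in the Lie algebra correspond at \<open>p\<close> to the
  classes of the vertical vectors they generate. The kernel of \<open>\<rho>\<close> at \<open>x\<close> is the set of \<open>v\<close> which it
  maps to the zero coset \<^const>\<open>ad01\<close>.\<close>

definition complex_string_algebroid :: "('x, 'a::euclidean_space) manifold \<Rightarrow> 'g monoid \<Rightarrow> ('g, 'h::euclidean_space) manifold \<Rightarrow> ('h \<Rightarrow> 'h) \<Rightarrow>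
    (('g, real) tvec \<Rightarrow> ('g, real) tvec \<Rightarrow> complex) \<Rightarrow> ('p, 'b::euclidean_space) manifold \<Rightarrow> ('p \<Rightarrow> 'x) \<Rightarrow> ('p \<Rightarrow> 'g \<Rightarrow> 'p) \<Rightarrow>
    ('x, 'v::ab_group_add, complex) courant \<Rightarrow> ('x \<Rightarrow> 'v \<Rightarrow> ('p \<Rightarrow> ('p, complex) tvec) set) \<Rightarrow> bool" where
  "complex_string_algebroid X G GM J B P q act E \<rho> \<longleftrightarrow>
     principal_bundle X G GM P q act \<and> courant_algebroid X E \<and>
     (\<forall>x\<in>mcarrier X. \<forall>v\<in>total E `` {x}. \<rho> x v \<in> complex_atiyah G GM J P q act x) \<and>
     (\<forall>x\<in>mcarrier X. \<forall>v\<in>total E `` {x}. \<forall>w\<in>total E `` {x}. \<forall>a\<in>\<rho> x v. \<forall>b\<in>\<rho> x w.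
        a + b \<in> \<rho> x (v + w)) \<and>
     (\<forall>x\<in>mcarrier X. \<forall>v\<in>total E `` {x}. \<forall>a\<in>\<rho> x v. \<forall>c.
        (\<lambda>p. tscale c (a p)) \<in> \<rho> x (scal E c v)) \<and>
     (\<forall>U u. openin (mtop X) U \<and> smooth_section X E U u \<longrightarrow>
        (\<exists>A. smooth_vfield P {p \<in> mcarrier P. q p \<in> U} A \<and>
          (\<forall>x\<in>U. along_fibre P q x A \<in> \<rho> x (u x)))) \<and>
     (\<forall>x\<in>mcarrier X. \<forall>v\<in>total E `` {x}. \<forall>a\<in>\<rho> x v. \<forall>p\<in>fibre_over P q x.
        push X q p (a p) = anchor E x v) \<and>
     (\<forall>u\<in>sections X E. \<forall>v\<in>sections X E. \<forall>A C.
        smooth_vfield P (mcarrier P) A \<and> (\<forall>x\<in>mcarrier X. along_fibre P q x A \<in> \<rho> x (u x)) \<and>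
        smooth_vfield P (mcarrier P) C \<and> (\<forall>x\<in>mcarrier X. along_fibre P q x C \<in> \<rho> x (v x)) \<longrightarrow>
        (\<forall>x\<in>mcarrier X. along_fibre P q x (lie_bracket P A C) \<in> \<rho> x (bracket E u v x))) \<and>
     (\<forall>x\<in>mcarrier X. inj_on (coanchor E x) (cotangent_space X x) \<and>
        coanchor E x ` cotangent_space X x = {v \<in> total E `` {x}. \<rho> x v = ad01 G GM J P q act x} \<and>
        \<rho> x ` (total E `` {x}) = complex_atiyah G GM J P q act x) \<and>
     (\<forall>x\<in>mcarrier X. {v \<in> total E `` {x}. \<rho> x v = ad01 G GM J P q act x} =
        fibre_perp E x (anchor_kernel E x)) \<and>
     (\<forall>x\<in>mcarrier X. \<forall>v\<in>anchor_kernel E x. \<forall>w\<in>anchor_kernel E x. \<forall>p\<in>fibre_over P q x.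
        \<forall>a\<in>\<rho> x v. \<forall>b\<in>\<rho> x w. \<forall>\<xi>\<in>lie_alg G GM. \<forall>\<eta>\<in>lie_alg G GM.
          a p = push P (act p) \<one>\<^bsub>G\<^esub> (cplx GM \<one>\<^bsub>G\<^esub> \<xi>) \<and>
          b p = push P (act p) \<one>\<^bsub>G\<^esub> (cplx GM \<one>\<^bsub>G\<^esub> \<eta>) \<longrightarrow>
          pairing E x v w = B \<xi> \<eta>)"

definition real_string_algebroid :: "('x, 'a::euclidean_space) manifold \<Rightarrow> 'g monoid \<Rightarrow> ('g, 'l::euclidean_space) manifold \<Rightarrow>
    (('g, real) tvec \<Rightarrow> ('g, real) tvec \<Rightarrow> real) \<Rightarrow> ('p, 'c::euclidean_space) manifold \<Rightarrow> ('p \<Rightarrow> 'x) \<Rightarrow> ('p \<Rightarrow> 'g \<Rightarrow> 'p) \<Rightarrow>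
    ('x, 'v::ab_group_add, real) courant \<Rightarrow> ('x \<Rightarrow> 'v \<Rightarrow> 'p \<Rightarrow> ('p, real) tvec) \<Rightarrow> bool" where
  "real_string_algebroid X K KM B P q act E \<rho> \<longleftrightarrow>
     principal_bundle X K KM P q act \<and> courant_algebroid X E \<and>
     (\<forall>x\<in>mcarrier X. \<forall>v\<in>total E `` {x}. \<rho> x v \<in> TP_mod_G K P q act x) \<and>
     (\<forall>x\<in>mcarrier X. \<forall>v\<in>total E `` {x}. \<forall>w\<in>total E `` {x}. \<rho> x (v + w) = \<rho> x v + \<rho> x w) \<and>
     (\<forall>x\<in>mcarrier X. \<forall>v\<in>total E `` {x}. \<forall>c. \<rho> x (scal E c v) = (\<lambda>p. tscale c (\<rho> x v p))) \<and>
     (\<forall>U u. openin (mtop X) U \<and> smooth_section X E U u \<longrightarrow>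
        smooth_vfield P {p \<in> mcarrier P. q p \<in> U} (\<lambda>p. \<rho> (q p) (u (q p)) p)) \<and>
     (\<forall>x\<in>mcarrier X. \<forall>v\<in>total E `` {x}. \<forall>p\<in>fibre_over P q x.
        push X q p (\<rho> x v p) = anchor E x v) \<and>
     (\<forall>u\<in>sections X E. \<forall>v\<in>sections X E. \<forall>p\<in>mcarrier P.
        \<rho> (q p) (bracket E u v (q p)) p =
          lie_bracket P (\<lambda>p'. \<rho> (q p') (u (q p')) p') (\<lambda>p'. \<rho> (q p') (v (q p')) p') p) \<and>
     (\<forall>x\<in>mcarrier X. inj_on (coanchor E x) (cotangent_space X x) \<and>
        coanchor E x ` cotangent_space X x = {v \<in> total E `` {x}. \<rho> x v = 0} \<and>
        \<rho> x ` (total E `` {x}) = TP_mod_G K P q act x) \<and>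
     (\<forall>x\<in>mcarrier X. {v \<in> total E `` {x}. \<rho> x v = 0} = fibre_perp E x (anchor_kernel E x)) \<and>
     (\<forall>x\<in>mcarrier X. \<forall>v\<in>anchor_kernel E x. \<forall>w\<in>anchor_kernel E x. \<forall>p\<in>fibre_over P q x.
        \<forall>\<xi>\<in>lie_alg K KM. \<forall>\<eta>\<in>lie_alg K KM.
          \<rho> x v p = push P (act p) \<one>\<^bsub>K\<^esub> \<xi> \<and> \<rho> x w p = push P (act p) \<one>\<^bsub>K\<^esub> \<eta> \<longrightarrow>
          pairing E x v w = B \<xi> \<eta>)"


section \<open>Liftings, compact forms and horizontal lifts\<close>

definition lifting :: "('x, 'a::euclidean_space) manifold \<Rightarrow> ('a \<Rightarrow> 'a) \<Rightarrow> ('x, 'v::ab_group_add, complex) courant \<Rightarrow> ('x \<times> 'v) set \<Rightarrow> bool" where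
  "lifting X J E L \<longleftrightarrow> (\<exists>r. subbundle X E L r) \<and>
     (\<forall>x\<in>mcarrier X. \<forall>v\<in>L `` {x}. \<forall>w\<in>L `` {x}. pairing E x v w = 0) \<and>
     (\<forall>u\<in>sections X E. \<forall>v\<in>sections X E.
        (\<forall>x\<in>mcarrier X. (x, u x) \<in> L \<and> (x, v x) \<in> L) \<longrightarrow>
        (\<forall>x\<in>mcarrier X. (x, bracket E u v x) \<in> L)) \<and>
     (\<forall>x\<in>mcarrier X. bij_betw (anchor E x) (L `` {x}) (T01 X J x))"

text \<open>The principal \<open>K\<close>-bundle \<open>PR\<close> has its own manifold structure, while its projection and action
  are those of \<open>P\<close>.\<close>

definition reduction :: "('x, 'a::euclidean_space) manifold \<Rightarrow> 'g monoid \<Rightarrow> 'g set \<Rightarrow> ('g, 'l::euclidean_space) manifold \<Rightarrow>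
    ('p, 'b::euclidean_space) manifold \<Rightarrow> ('p \<Rightarrow> 'x) \<Rightarrow> ('p \<Rightarrow> 'g \<Rightarrow> 'p) \<Rightarrow> ('p, 'c::euclidean_space) manifold \<Rightarrow> bool" where
  "reduction X G K KM P q act PR \<longleftrightarrow> mcarrier PR \<subseteq> mcarrier P \<and> smooth_map PR P (\<lambda>p. p) \<and>
     principal_bundle X (G\<lparr>carrier := K\<rparr>) KM PR q act"

definition complexification :: "('x, 'v::ab_group_add, complex) courant \<Rightarrow> ('x \<times> 'v) set \<Rightarrow> ('x \<times> 'v) set" where
  "complexification E W = {(x, a + scal E \<i> b) | x a b. (x, a) \<in> W \<and> (x, b) \<in> W}"

definition compact_form :: "('x, 'a::euclidean_space) manifold \<Rightarrow> 'g monoid \<Rightarrow> ('g, 'h::euclidean_space) manifold \<Rightarrow>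
    'g set \<Rightarrow> ('g, 'l::euclidean_space) manifold \<Rightarrow>
    (('g, real) tvec \<Rightarrow> ('g, real) tvec \<Rightarrow> complex) \<Rightarrow> ('p, 'b::euclidean_space) manifold \<Rightarrow> ('p \<Rightarrow> 'x) \<Rightarrow> ('p \<Rightarrow> 'g \<Rightarrow> 'p) \<Rightarrow>
    ('x, 'v::ab_group_add, complex) courant \<Rightarrow> ('x \<Rightarrow> 'v \<Rightarrow> ('p \<Rightarrow> ('p, complex) tvec) set) \<Rightarrow>
    ('p, 'c::euclidean_space) manifold \<Rightarrow>
    ('x, 'v, real) courant \<Rightarrow> ('x \<Rightarrow> 'v \<Rightarrow> 'p \<Rightarrow> ('p, real) tvec) \<Rightarrow> bool" where
  "compact_form X G GM K KM B P q act E \<rho> PR ER \<rho>R \<longleftrightarrow>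
     reduction X G K KM P q act PR \<and>
     real_string_algebroid X (G\<lparr>carrier := K\<rparr>) KM (\<lambda>\<xi> \<eta>. Re (restrict_form G GM B \<xi> \<eta>)) PR q act ER \<rho>R \<and>
     \<comment> \<open>\<open>E\<close> is the complexification of \<open>ER\<close> as a smooth vector bundle\<close>
     total ER \<subseteq> total E \<and> (\<forall>c v. scal ER c v = scal E (of_real c) v) \<and>
     (\<forall>(x, e)\<in>total E. \<exists>!(a, b). (x, a) \<in> total ER \<and> (x, b) \<in> total ER \<and> e = a + scal E \<i> b) \<and>
     (\<forall>U a b. openin (mtop X) U \<and> (\<forall>x\<in>U. (x, a x) \<in> total ER \<and> (x, b x) \<in> total ER) \<longrightarrow>
        (smooth_section X E U (\<lambda>x. a x + scal E \<i> (b x)) \<longleftrightarrow>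
         smooth_section X ER U a \<and> smooth_section X ER U b)) \<and>
     \<comment> \<open>the structure of \<open>E\<close> extends that of \<open>ER\<close>\<close>
     (\<forall>u\<in>sections X ER. \<forall>v\<in>sections X ER. bracket E u v = bracket ER u v) \<and>
     (\<forall>x\<in>mcarrier X. \<forall>v\<in>total ER `` {x}. \<forall>w\<in>total ER `` {x}.
        pairing E x v w = of_real (pairing ER x v w)) \<and>
     (\<forall>x\<in>mcarrier X. \<forall>v\<in>total ER `` {x}. anchor E x v = cplx X x (anchor ER x v)) \<and>
     \<comment> \<open>compatibility with the inclusion of cotangent bundles; \<open>\<beta>\<close> is the complex extension of \<open>\<alpha>\<close>\<close>
     (\<forall>x\<in>mcarrier X. \<forall>\<alpha>\<in>cotangent_space X x. \<forall>\<beta>\<in>cotangent_space X x.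
        (\<forall>t\<in>tangent_space X x. \<beta> (cplx X x t) = of_real (\<alpha> t)) \<longrightarrow>
        coanchor E x \<beta> = coanchor ER x \<alpha>) \<and>
     \<comment> \<open>compatibility with the injection of Atiyah algebroids, which extends \<open>K\<close>-equivariant fields
        along a fibre of \<open>PR\<close> to \<open>G\<close>-equivariant ones along the fibre of \<open>P\<close>\<close>
     (\<forall>x\<in>mcarrier X. \<forall>v\<in>total ER `` {x}. \<exists>a\<in>\<rho> x v. \<forall>p\<in>fibre_over PR q x.
        a p = cplx P p (push P (\<lambda>p'. p') p (\<rho>R x v p)))"

definition horizontal_lift :: "('x, 'a::euclidean_space) manifold \<Rightarrow> ('x, 'v::ab_group_add, real) courant \<Rightarrow> ('x \<times> 'v) set \<Rightarrow> bool" where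
  "horizontal_lift X ER W \<longleftrightarrow> subbundle X ER W (dim (mmodel X)) \<and>
     (\<forall>x\<in>mcarrier X. W `` {x} \<inter> anchor_kernel ER x = {0})"

end

theory Submission
  imports Defs
begin

text \<open>Write an element of \<open>E = E\<^sub>R \<otimes> \<complex>\<close> as \<open>a + \<i> b\<close> with \<open>a\<close>, \<open>b\<close> in \<open>E\<^sub>R\<close>. It projects into \<open>T\<^sup>0\<^sup>,\<^sup>1X\<close> iff
  \<open>\<pi> b = J (\<pi> a)\<close>, so \<open>L\<close> is a complex subspace of such elements in each fibre, and taking real parts
  followed by \<open>\<pi>\<close> identifies it with the real tangent space. Hence the set \<open>W\<close> of real parts of
  elements of \<open>L\<close> maps isomorphically onto the tangent space; it contains the imaginary parts too,
  as \<open>L\<close> is closed under multiplication by \<open>\<i>\<close>, and the real and imaginary parts of a local frame of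
  \<open>L\<close> form one of \<open>W\<close>. Any other candidate contains \<open>W\<close> by uniqueness of the real part, and equals
  \<open>W\<close> because \<open>\<pi>\<close> is injective on it.\<close>

section \<open>Smooth functions\<close>

text \<open>The difficulty lies in how tangent vectors are encoded: they are functionals on
  functions, \<open>tangent_J\<close> is a definite description, and charts take values in a linear
  subspace, where a derivative is determined only in directions of that subspace. So
  \<open>chart_coords\<close> is shown to identify each tangent space with the model space; there
  \<pi> b = J (\<pi> a) becomes an equation between vectors, and the claim in one fibre is linear
  algebra over a real form. Injectivity of taking real parts comes from that of \<pi> on L: if \<pi>
  a = 0 then \<pi> b = J 0 = 0, so a + \<i> b and 0 have the same anchor. The rank of L is given
  only as some r; its frame yields 2 r real vectors which \<pi> carries to a basis of the model
  space, and this forces 2 r to be the required dimension. Fibres carry no topology, so smoothness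
  of the frame rests on the clause that a section of E is smooth iff its real and imaginary parts
  are.\<close>

lemma Ck_on_cong:
  assumes "open S" "\<And>x. x \<in> S \<Longrightarrow> f x = g x" "Ck_on k S f"
  shows "Ck_on k S g"
  using assms(2,3)
proof (induction k arbitrary: f g)
  case 0
  then show ?case by (simp cong: continuous_on_cong)
next
  case (Suc k)
  have der: "(g has_derivative frechet_derivative f (at x)) (at x)" if "x \<in> S" for x
  proof (rule has_derivative_transform_within_open[OF _ assms(1) that])
    show "(f has_derivative frechet_derivative f (at x)) (at x)"
      using Suc.prems(2) that frechet_derivative_works by auto
  qed (use Suc.prems(1) in auto)
  then have "frechet_derivative f (at x) v = frechet_derivative g (at x) v" if "x \<in> S" for x v
    using that frechet_derivative_at by metis
  then have "Ck_on k S (\<lambda>x. frechet_derivative g (at x) v)" for v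
    using Suc.IH[of "\<lambda>x. frechet_derivative f (at x) v" "\<lambda>x. frechet_derivative g (at x) v"]
      Suc.prems(2) by auto
  moreover have "g differentiable (at x)" if "x \<in> S" for x
    using der[OF that] by (auto simp: differentiable_def)
  ultimately show ?case by simp
qed

text \<open>For an affine inner map the chain rule produces the derivative of \<open>f\<close> in
  the constant direction \<open>A v\<close>, composed with the same affine map, so the induction
  closes without a product rule. Affine maps suffice because the only curves to be constructed are
  straight lines in a chart.\<close>

lemma Ck_on_compose_affine:
  assumes "bounded_linear A" "open S" "Ck_on k S f"
  shows "Ck_on k ((\<lambda>t. p + A t) -` S) (\<lambda>t. f (p + A t))"
  using assms(3)
proof (induction k arbitrary: f)
  interpret A: bounded_linear A by fact
  let ?\<alpha> = "\<lambda>t. p + A t"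
  have cont: "continuous_on UNIV ?\<alpha>"
    by (intro continuous_intros A.continuous_on)
  case 0
  then show ?case
    using continuous_on_compose2[of S f "?\<alpha> -` S" ?\<alpha>] continuous_on_subset[OF cont] by auto
next
  interpret A: bounded_linear A by fact
  let ?\<alpha> = "\<lambda>t. p + A t"
  have cont: "continuous_on UNIV ?\<alpha>"
    by (intro continuous_intros A.continuous_on)
  then have op: "open (?\<alpha> -` S)"
    using assms(2) by (simp add: open_vimage)
  case (Suc k)
  have der: "((\<lambda>t. f (?\<alpha> t)) has_derivative (\<lambda>v. frechet_derivative f (at (?\<alpha> t)) (A v))) (at t)"
    if "t \<in> ?\<alpha> -` S" for t
  proof -
    have "(?\<alpha> has_derivative A) (at t)"
      using A.has_derivative[OF has_derivative_ident] by (auto intro!: derivative_eq_intros)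
    moreover have "(f has_derivative frechet_derivative f (at (?\<alpha> t))) (at (?\<alpha> t))"
      using Suc.prems that frechet_derivative_works by auto
    ultimately show ?thesis
      using diff_chain_at[of ?\<alpha> A t f] by (simp add: o_def)
  qed
  then have eq: "frechet_derivative (\<lambda>t. f (?\<alpha> t)) (at t) v = frechet_derivative f (at (?\<alpha> t)) (A v)"
    if "t \<in> ?\<alpha> -` S" for t v
    using that frechet_derivative_at by metis
  have "Ck_on k (?\<alpha> -` S) (\<lambda>t. frechet_derivative (\<lambda>t. f (?\<alpha> t)) (at t) v)" for v
    by (rule Ck_on_cong[OF op _ Suc.IH[of "\<lambda>y. frechet_derivative f (at y) (A v)"]])
       (use Suc.prems eq in auto)
  then show ?case
    using der by (auto simp: differentiable_def)
qed

text \<open>A bounded linear map commutes with differentiation. It is applied to the coordinate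
  functionals \<open>\<phi> y \<bullet> b\<close> and to the embedding of the reals into the complex
  numbers.\<close>

lemma Ck_on_linear_compose:
  assumes "bounded_linear A" "open S" "Ck_on k S f"
  shows "Ck_on k S (\<lambda>x. A (f x))"
  using assms(3)
proof (induction k arbitrary: f)
  case 0
  then show ?case
    using assms(1) by (simp add: bounded_linear.continuous_on)
next
  case (Suc k)
  have der: "((\<lambda>x. A (f x)) has_derivative (\<lambda>v. A (frechet_derivative f (at x) v))) (at x)"
    if "x \<in> S" for x
    using Suc.prems that frechet_derivative_works
    by (auto intro!: bounded_linear.has_derivative[OF assms(1)])
  then have eq: "frechet_derivative (\<lambda>x. A (f x)) (at x) v = A (frechet_derivative f (at x) v)"
    if "x \<in> S" for x v
    using that frechet_derivative_at by metis
  have "Ck_on k S (\<lambda>x. frechet_derivative (\<lambda>x. A (f x)) (at x) v)" for v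
    by (rule Ck_on_cong[OF assms(2) _ Suc.IH[of "\<lambda>y. frechet_derivative f (at y) v"]])
       (use Suc.prems eq in auto)
  then show ?case
    using der by (auto simp: differentiable_def)
qed

lemma smooth_on_linear_compose:
  assumes "bounded_linear A" "smooth_on S f"
  shows "smooth_on S (\<lambda>x. A (f x))"
  unfolding smooth_on_def
proof
  fix x assume "x \<in> S"
  then obtain U g where "open U" "x \<in> U" "\<forall>k. Ck_on k U g" "\<forall>y\<in>S \<inter> U. g y = f y"
    using assms(2) unfolding smooth_on_def by blast
  then have "open U \<and> x \<in> U \<and> (\<forall>k. Ck_on k U (\<lambda>x. A (g x))) \<and> (\<forall>y\<in>S \<inter> U. A (g y) = A (f y))"
    using Ck_on_linear_compose[OF assms(1), of U _ g] by auto
  then show "\<exists>U g. open U \<and> x \<in> U \<and> (\<forall>k. Ck_on k U g) \<and> (\<forall>y\<in>S \<inter> U. g y = A (f y))"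
    by blast
qed

lemma smooth_on_compose_affine:
  assumes "bounded_linear A" "smooth_on S f" "\<And>t. t \<in> T \<Longrightarrow> p + A t \<in> S"
  shows "smooth_on T (\<lambda>t. f (p + A t))"
  unfolding smooth_on_def
proof
  interpret A: bounded_linear A by fact
  have cont: "continuous_on UNIV (\<lambda>t. p + A t)"
    by (intro continuous_intros A.continuous_on)
  fix t assume "t \<in> T"
  then have "p + A t \<in> S"
    by (rule assms(3))
  then obtain U g where U: "open U" "p + A t \<in> U" "\<forall>k. Ck_on k U g" "\<forall>y\<in>S \<inter> U. g y = f y"
    using assms(2) unfolding smooth_on_def by meson
  let ?U = "(\<lambda>t. p + A t) -` U"
  have "open ?U" "t \<in> ?U" "\<forall>y\<in>T \<inter> ?U. g (p + A y) = f (p + A y)"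
    using open_vimage[OF U(1) cont] U(2,4) assms(3) by auto
  moreover have "\<forall>k. Ck_on k ?U (\<lambda>t. g (p + A t))"
    using Ck_on_compose_affine[OF assms(1) U(1)] U(3) by blast
  ultimately show "\<exists>U g. open U \<and> t \<in> U \<and> (\<forall>k. Ck_on k U g) \<and> (\<forall>y\<in>T \<inter> U. g y = f (p + A y))"
    by blast
qed

text \<open>The derivative of a local extension, restricted to \<open>S\<close>. If \<open>S\<close>
  lies in a proper subspace, different extensions may give different \<open>D\<close>, so
  \<open>D\<close> is only claimed to exist.\<close>

lemma smooth_on_has_derivative:
  assumes "smooth_on S f" "x \<in> S"
  obtains D where "(f has_derivative D) (at x within S)"
proof -
  obtain U g where U: "open U" "x \<in> U" "\<And>k. Ck_on k U g" "\<And>y. y \<in> S \<inter> U \<Longrightarrow> g y = f y"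
    using assms unfolding smooth_on_def by metis
  have "g differentiable (at x)"
    using U(3)[of "Suc 0"] U(2) by simp
  then have "(g has_derivative frechet_derivative g (at x)) (at x within S)"
    using frechet_derivative_works has_derivative_at_withinI by blast
  moreover obtain d where "d > 0" "\<forall>y. dist y x < d \<longrightarrow> y \<in> U"
    using U(1,2) by (auto simp: open_dist)
  ultimately have "(f has_derivative frechet_derivative g (at x)) (at x within S)"
    using U(4) assms(2) by (intro has_derivative_transform_within[of g _ _ _ d f]) auto
  then show thesis by (rule that)
qed

section \<open>Tangent spaces in charts\<close>

lemma smooth_near_linear_compose:
  assumes "bounded_linear A" "smooth_near M x f"
  shows "smooth_near M x (\<lambda>y. A (f y))"
proof -
  obtain S where "openin (mtop M) S" "x \<in> S" "smooth_fun M S f"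
    using assms(2) unfolding smooth_near_def by blast
  moreover from this have "smooth_fun M S (\<lambda>y. A (f y))"
    using smooth_on_linear_compose[OF assms(1)] unfolding smooth_fun_def o_def by fast
  ultimately show ?thesis
    unfolding smooth_near_def by blast
qed

lemma smooth_near_chart:
  assumes "smooth_manifold M" "(U, \<phi>) \<in> atlas M" "x \<in> U"
  shows "smooth_near M x \<phi>"
proof -
  have "openin (mtop M) U"
    using assms unfolding smooth_manifold_def by blast
  moreover have "smooth_fun M U \<phi>"
    using assms(1,2) unfolding smooth_manifold_def smooth_fun_def by blast
  ultimately show ?thesis
    using assms(3) unfolding smooth_near_def by blast
qed

section \<open>Curves and their velocities in a chart\<close>

lemma smooth_map_on_real_line_iff:
  "smooth_map_on real_line I M \<gamma> \<longleftrightarrow> continuous_map (top_of_set I) (mtop M) \<gamma> \<and>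
     (\<forall>(V, \<psi>)\<in>atlas M. smooth_on {t \<in> I. \<gamma> t \<in> V} (\<psi> \<circ> \<gamma>))"
proof -
  have "inv_into UNIV (\<lambda>t::real. t) = (\<lambda>t. t)"
    by (simp add: fun_eq_iff inv_f_eq inj_def)
  then show ?thesis
    by (simp add: smooth_map_on_def real_line_def o_def)
qed

lemma open_preimage_curve:
  assumes "open I" "continuous_map (top_of_set I) T \<gamma>" "openin T V"
  shows "open {t \<in> I. \<gamma> t \<in> V}"
proof -
  have "openin (top_of_set I) {t \<in> I. \<gamma> t \<in> V}"
    using openin_continuous_map_preimage[OF assms(2,3)] by simp
  then show ?thesis
    using assms(1) openin_open_eq by blast
qed

text \<open>The condition on the generators of \<open>tangent_space\<close>, named so that
  statements about tangent vectors can be proved by induction over the span of velocities.\<close>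

definition curve_at :: "('m, 'a::euclidean_space) manifold \<Rightarrow> 'm \<Rightarrow> (real \<Rightarrow> 'm) \<Rightarrow> bool" where
  "curve_at M x \<gamma> \<longleftrightarrow> \<gamma> 0 = x \<and> (\<exists>I. open I \<and> 0 \<in> I \<and> smooth_map_on real_line I M \<gamma>)"

lemma curve_at_nhd:
  assumes "curve_at M x \<gamma>" "openin (mtop M) V" "x \<in> V"
  obtains T where "open T" "0 \<in> T" "\<gamma> ` T \<subseteq> V"
proof -
  obtain I where I: "open I" "0 \<in> I" "smooth_map_on real_line I M \<gamma>" "\<gamma> 0 = x"
    using assms(1) unfolding curve_at_def by blast
  then have "open {t \<in> I. \<gamma> t \<in> V}"
    using open_preimage_curve assms(2) smooth_map_on_real_line_iff by blast
  then show thesis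
    using I assms(3) by (intro that[of "{t \<in> I. \<gamma> t \<in> V}"]) auto
qed

lemma curve_at_derivative:
  assumes "smooth_manifold M" "curve_at M x \<gamma>" "(U, \<phi>) \<in> atlas M" "x \<in> U"
  obtains c where "((\<lambda>t. \<phi> (\<gamma> t)) has_vector_derivative c) (at 0)" "c \<in> mmodel M"
proof -
  have sub: "subspace (mmodel M)" and op: "openin (mtop M) U"
    and im: "\<phi> ` U \<subseteq> mmodel M"
    using assms(1,3) openin_imp_subset unfolding smooth_manifold_def by blast+
  obtain I where I: "open I" "0 \<in> I" "smooth_map_on real_line I M \<gamma>" "\<gamma> 0 = x"
    using assms(2) unfolding curve_at_def by blast
  define T where "T = {t \<in> I. \<gamma> t \<in> U}"
  have T: "open T" "0 \<in> T" "smooth_on T (\<phi> \<circ> \<gamma>)"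
    using I open_preimage_curve[OF I(1) _ op] assms(3,4)
    unfolding smooth_map_on_real_line_iff T_def by auto
  then obtain D where "((\<phi> \<circ> \<gamma>) has_derivative D) (at 0 within T)"
    using smooth_on_has_derivative by metis
  then have "(\<phi> \<circ> \<gamma>) differentiable (at 0)"
    using T at_within_open[OF T(2,1)] by (auto simp: differentiable_def)
  then obtain c where D': "((\<phi> \<circ> \<gamma>) has_vector_derivative c) (at 0)"
    using vector_derivative_works by blast
  \<comment> \<open>A functional vanishing on the model space vanishes along the curve, hence on its
    velocity. The double orthogonal complement then returns the model space itself.\<close>
  have "c \<bullet> y = 0" if "y \<in> orthogonal_comp (mmodel M)" for y
  proof -
    have "((\<lambda>t. (\<phi> \<circ> \<gamma>) t \<bullet> y) has_vector_derivative c \<bullet> y) (at 0)"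
      using bounded_linear.has_vector_derivative[OF bounded_linear_inner_left D'] .
    moreover have "((\<lambda>t. (\<phi> \<circ> \<gamma>) t \<bullet> y) has_vector_derivative 0) (at 0)"
    proof (rule has_vector_derivative_transform_within_open[OF has_vector_derivative_const T(1,2)])
      show "0 = (\<phi> \<circ> \<gamma>) t \<bullet> y" if "t \<in> T" for t
      proof -
        have "(\<phi> \<circ> \<gamma>) t \<in> mmodel M"
          using that im by (auto simp: T_def)
        then show ?thesis
          using \<open>y \<in> _\<close> by (simp add: orthogonal_comp_def orthogonal_def)
      qed
    qed
    ultimately show ?thesis
      using vector_derivative_unique_at by blast
  qed
  then have "c \<in> orthogonal_comp (orthogonal_comp (mmodel M))"
    by (auto simp: orthogonal_comp_def orthogonal_def inner_commute)
  then have "c \<in> mmodel M"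
    using orthogonal_comp_self[OF sub] by simp
  then show thesis
    using that D' by (simp add: o_def)
qed

lemma curve_at_chain:
  assumes "curve_at M x \<gamma>" "openin (mtop M) S" "x \<in> S" "S \<subseteq> U" "inj_on \<phi> U"
    and "((\<lambda>t. \<phi> (\<gamma> t)) has_vector_derivative c) (at 0)"
    and "((F \<circ> inv_into U \<phi>) has_derivative D) (at (\<phi> x) within \<phi> ` S)"
  shows "((\<lambda>t. F (\<gamma> t)) has_vector_derivative D c) (at 0)"
proof -
  obtain T where T: "open T" "0 \<in> T" "\<gamma> ` T \<subseteq> S"
    using curve_at_nhd assms(1-3) by metis
  have x: "\<gamma> 0 = x"
    using assms(1) by (simp add: curve_at_def)
  have "((\<lambda>t. \<phi> (\<gamma> t)) has_derivative (\<lambda>h. h *\<^sub>R c)) (at 0 within T)"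
    using assms(6) has_derivative_at_withinI unfolding has_vector_derivative_def by blast
  moreover have "((F \<circ> inv_into U \<phi>) has_derivative D) (at (\<phi> (\<gamma> 0)) within (\<lambda>t. \<phi> (\<gamma> t)) ` T)"
    using T(3) x by (intro has_derivative_subset[OF assms(7)[folded x]]) auto
  ultimately have "((F \<circ> inv_into U \<phi> \<circ> (\<lambda>t. \<phi> (\<gamma> t))) has_derivative (D \<circ> (\<lambda>h. h *\<^sub>R c))) (at 0 within T)"
    by (rule diff_chain_within)
  then have "((F \<circ> inv_into U \<phi> \<circ> (\<lambda>t. \<phi> (\<gamma> t))) has_derivative (D \<circ> (\<lambda>h. h *\<^sub>R c))) (at 0)"
    using at_within_open[OF T(2,1)] by simp
  then have "((\<lambda>t. F (\<gamma> t)) has_derivative (D \<circ> (\<lambda>h. h *\<^sub>R c))) (at 0)"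
  proof (rule has_derivative_transform_within_open[OF _ T(1,2)])
    show "(F \<circ> inv_into U \<phi> \<circ> (\<lambda>t. \<phi> (\<gamma> t))) t = F (\<gamma> t)" if "t \<in> T" for t
    proof -
      have "\<gamma> t \<in> U"
        using that T(3) assms(4) by blast
      then show ?thesis
        using assms(5) by simp
    qed
  qed
  moreover have "D \<circ> (\<lambda>h. h *\<^sub>R c) = (\<lambda>h. h *\<^sub>R D c)"
    using linear_cmul[OF has_derivative_linear[OF assms(7)]] by (simp add: o_def)
  ultimately show ?thesis
    by (simp add: has_vector_derivative_def)
qed

lemma chart_inj_on:
  assumes "smooth_manifold M" "(U, \<phi>) \<in> atlas M"
  shows "inj_on \<phi> U"
proof -
  have "openin (mtop M) U" "homeomorphic_map (subtopology (mtop M) U) (top_of_set (\<phi> ` U)) \<phi>"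
    using assms unfolding smooth_manifold_def by blast+
  then show ?thesis
    by (metis homeomorphic_imp_injective_map openin_subset topspace_subtopology_subset)
qed

lemma chart_openin:
  assumes "smooth_manifold M" "(U, \<phi>) \<in> atlas M"
  shows "openin (mtop M) U" "openin (top_of_set (mmodel M)) (\<phi> ` U)"
  using assms unfolding smooth_manifold_def by blast+

text \<open>The order of quantifiers is the point: one \<open>D\<close>, depending on
  \<open>f\<close> and the chart, serves all curves through \<open>x\<close>. A velocity therefore
  depends only on the derivative of the curve in the chart.\<close>

lemma velocity_chart:
  fixes f :: "'m \<Rightarrow> 'k::real_normed_field"
  assumes "smooth_manifold M" "(U, \<phi>) \<in> atlas M" "x \<in> U" "smooth_near M x f"
  obtains D where "linear D"
    "\<And>\<gamma> c. curve_at M x \<gamma> \<Longrightarrow> ((\<lambda>t. \<phi> (\<gamma> t)) has_vector_derivative c) (at 0) \<Longrightarrow> velocity M \<gamma> f = D c"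
proof -
  obtain S where S: "openin (mtop M) S" "x \<in> S" "smooth_fun M S f"
    using assms(4) unfolding smooth_near_def by blast
  then have "smooth_on (\<phi> ` (U \<inter> S)) (f \<circ> inv_into U \<phi>)"
    using assms(2) unfolding smooth_fun_def by blast
  then obtain D where D: "((f \<circ> inv_into U \<phi>) has_derivative D) (at (\<phi> x) within \<phi> ` (U \<inter> S))"
    using smooth_on_has_derivative assms(3) S(2) by blast
  have "velocity M \<gamma> f = D c"
    if "curve_at M x \<gamma>" "((\<lambda>t. \<phi> (\<gamma> t)) has_vector_derivative c) (at 0)" for \<gamma> c
  proof -
    have "((\<lambda>t. f (\<gamma> t)) has_vector_derivative D c) (at 0)"
      using chart_openin[OF assms(1,2)] chart_inj_on[OF assms(1,2)] S assms(3)
      by (intro curve_at_chain[OF that(1) _ _ _ _ that(2) D]) auto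
    then show ?thesis
      using assms(4) that(1) by (simp add: velocity_def curve_at_def vector_derivative_at)
  qed
  then show thesis
    using that has_derivative_linear[OF D] by blast
qed

section \<open>Linear structure of tangent spaces and their chart coordinates\<close>

lemma vector_space_tscale: "vector_space (tscale :: 'k::real_normed_field \<Rightarrow> ('m, 'k) tvec \<Rightarrow> ('m, 'k) tvec)"
  by standard (auto simp: tscale_def fun_eq_iff algebra_simps)

interpretation tvec: vector_space tscale
  by (rule vector_space_tscale)

lemma tangent_space_eq: "tangent_space M x = tvec.span {velocity M \<gamma> | \<gamma>. curve_at M x \<gamma>}"
  by (simp add: tangent_space_def curve_at_def)

lemma tangent_space_subspace: "tvec.subspace (tangent_space M x)"
  by (simp add: tangent_space_eq tvec.subspace_span)

text \<open>Velocities have the default value 0 on functions not smooth near the base point, and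
  linear combinations inherit it. Two tangent vectors at \<open>x\<close> thus need comparing only
  on functions smooth near \<open>x\<close>.\<close>

lemma tangent_eq_0:
  assumes "u \<in> tangent_space M x" "\<not> smooth_near M x f"
  shows "u f = 0"
  using assms(1) unfolding tangent_space_eq
proof (induction rule: tvec.span_induct_alt)
  case (step c v w)
  then show ?case
    using assms(2) by (auto simp: tscale_def velocity_def curve_at_def)
qed simp

lemma chart_coords_add: "chart_coords \<phi> (u + w) = chart_coords \<phi> u + chart_coords \<phi> w"
  by (simp add: chart_coords_def scaleR_add_left sum.distrib)

lemma chart_coords_tscale: "chart_coords \<phi> (tscale c u) = c *\<^sub>R chart_coords \<phi> u"
  by (simp add: chart_coords_def tscale_def scaleR_sum_right)

lemma chart_coords_0: "chart_coords \<phi> 0 = 0"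
  by (simp add: chart_coords_def)

lemma chart_coords_velocity:
  assumes "smooth_manifold M" "(U, \<phi>) \<in> atlas M" "x \<in> U"
    and "curve_at M x \<gamma>" "((\<lambda>t. \<phi> (\<gamma> t)) has_vector_derivative c) (at 0)"
  shows "chart_coords \<phi> (velocity M \<gamma>) = c"
proof -
  have "velocity M \<gamma> (\<lambda>y. \<phi> y \<bullet> b) = c \<bullet> b" for b
  proof -
    have "smooth_near M (\<gamma> 0) (\<lambda>y. \<phi> y \<bullet> b)"
      using smooth_near_linear_compose[OF bounded_linear_inner_left smooth_near_chart[OF assms(1-3)]]
        assms(4) by (simp add: curve_at_def)
    then show ?thesis
      using bounded_linear.has_vector_derivative[OF bounded_linear_inner_left assms(5), of b]
      by (simp add: velocity_def vector_derivative_at)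
  qed
  then show ?thesis
    by (simp add: chart_coords_def euclidean_representation)
qed

lemma chart_coords_in_model:
  assumes "smooth_manifold M" "(U, \<phi>) \<in> atlas M" "x \<in> U" "u \<in> tangent_space M x"
  shows "chart_coords \<phi> u \<in> mmodel M"
proof -
  have sub: "subspace (mmodel M)"
    using assms(1) by (simp add: smooth_manifold_def)
  show ?thesis
    using assms(4) unfolding tangent_space_eq
  proof (induction rule: tvec.span_induct_alt)
    case base
    show ?case unfolding chart_coords_0 using sub by (rule subspace_0)
  next
    case (step c v w)
    then obtain \<gamma> where \<gamma>: "v = velocity M \<gamma>" "curve_at M x \<gamma>"
      by blast
    obtain d where "((\<lambda>t. \<phi> (\<gamma> t)) has_vector_derivative d) (at 0)" "d \<in> mmodel M"
      using curve_at_derivative[OF assms(1) \<gamma>(2) assms(2,3)] by blast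
    then have "chart_coords \<phi> v \<in> mmodel M"
      using chart_coords_velocity[OF assms(1-3) \<gamma>(2)] \<gamma>(1) by simp
    then show ?case
      unfolding chart_coords_add chart_coords_tscale
      using sub step by (intro subspace_add subspace_scale)
  qed
qed

text \<open>Both sides are linear in \<open>u\<close>, so \<open>velocity_chart\<close> extends from
  velocities to their span. As the coordinates determine every value \<open>u f\<close>, this is the
  injectivity of \<open>chart_coords\<close>.\<close>

lemma tangent_chart:
  fixes f :: "'m \<Rightarrow> real"
  assumes "smooth_manifold M" "(U, \<phi>) \<in> atlas M" "x \<in> U" "smooth_near M x f"
  obtains D where "linear D" "\<And>u. u \<in> tangent_space M x \<Longrightarrow> u f = D (chart_coords \<phi> u)"
proof -
  obtain D where D: "linear D" "\<And>\<gamma> c. curve_at M x \<gamma> \<Longrightarrow>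
      ((\<lambda>t. \<phi> (\<gamma> t)) has_vector_derivative c) (at 0) \<Longrightarrow> velocity M \<gamma> f = D c"
    using velocity_chart[OF assms] by blast
  have "u f = D (chart_coords \<phi> u)" if "u \<in> tangent_space M x" for u
    using that unfolding tangent_space_eq
  proof (induction rule: tvec.span_induct_alt)
    case base
    show ?case unfolding chart_coords_0 using D(1) by (simp add: linear_0)
  next
    case (step c v w)
    then obtain \<gamma> where \<gamma>: "v = velocity M \<gamma>" "curve_at M x \<gamma>"
      by blast
    obtain d where "((\<lambda>t. \<phi> (\<gamma> t)) has_vector_derivative d) (at 0)"
      using curve_at_derivative[OF assms(1) \<gamma>(2) assms(2,3)] by blast
    then have "v f = D (chart_coords \<phi> v)"
      using chart_coords_velocity[OF assms(1-3) \<gamma>(2)] \<gamma> D(2) by simp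
    then show ?case
      unfolding chart_coords_add chart_coords_tscale
      using D(1) step by (simp add: tscale_def linear_add linear_cmul)
  qed
  then show thesis
    using that D(1) by blast
qed

lemma chart_coords_inj:
  assumes "smooth_manifold M" "(U, \<phi>) \<in> atlas M" "x \<in> U"
  shows "inj_on (chart_coords \<phi>) (tangent_space M x)"
proof (rule inj_onI, rule ext)
  fix u w f assume uw: "u \<in> tangent_space M x" "w \<in> tangent_space M x" "chart_coords \<phi> u = chart_coords \<phi> w"
  show "u f = w f"
  proof (cases "smooth_near M x f")
    case True
    then obtain D where D: "\<And>u. u \<in> tangent_space M x \<Longrightarrow> u f = D (chart_coords \<phi> u)"
      using tangent_chart[OF assms] by blast
    show ?thesis
      using D[OF uw(1)] D[OF uw(2)] uw(3) by simp
  next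
    case False
    then show ?thesis
      using uw tangent_eq_0 by metis
  qed
qed

text \<open>The straight line through \<open>\<phi> x\<close> in direction \<open>v\<close>, pulled
  back by the chart, is a smooth curve with coordinate velocity \<open>v\<close>.\<close>

lemma chart_coords_surj:
  assumes "smooth_manifold M" "(U, \<phi>) \<in> atlas M" "x \<in> U" "v \<in> mmodel M"
  obtains u where "u \<in> tangent_space M x" "chart_coords \<phi> u = v"
proof -
  have sub: "subspace (mmodel M)"
    using assms(1) by (simp add: smooth_manifold_def)
  note U = chart_openin[OF assms(1,2)] and inj = chart_inj_on[OF assms(1,2)]
  obtain T where T: "open T" "\<phi> ` U = mmodel M \<inter> T"
    using U(2) by (auto simp: openin_open)
  \<comment> \<open>The chart image is the model space intersected with an open \<open>T\<close>.
    The line never leaves the model space, so it lies in the chart image exactly as long as it lies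
    in \<open>T\<close>.\<close>
  define \<alpha> where "\<alpha> t = \<phi> x + t *\<^sub>R v" for t :: real
  define I where "I = \<alpha> -` T"
  define \<gamma> where "\<gamma> t = inv_into U \<phi> (\<alpha> t)" for t
  have cont: "continuous_on UNIV \<alpha>"
    unfolding \<alpha>_def by (intro continuous_intros)
  then have I: "open I" "0 \<in> I"
    using T assms(3) by (auto simp: I_def \<alpha>_def open_vimage)
  have "\<phi> x \<in> mmodel M"
    using T(2) assms(3) by blast
  then have "\<alpha> t \<in> mmodel M" for t
    unfolding \<alpha>_def using sub assms(4) by (intro subspace_add subspace_scale)
  then have \<alpha>U: "\<alpha> t \<in> \<phi> ` U" if "t \<in> I" for t
    using that T(2) by (auto simp: I_def)
  then have \<gamma>: "\<gamma> t \<in> U" "\<phi> (\<gamma> t) = \<alpha> t" if "t \<in> I" for t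
    using that by (auto simp: \<gamma>_def inv_into_into f_inv_into_f)
  have "homeomorphic_map (subtopology (mtop M) U) (top_of_set (\<phi> ` U)) \<phi>"
    using assms(1,2) unfolding smooth_manifold_def by blast
  \<comment> \<open>The continuous inverse \<open>g\<close> supplies the continuity of
    \<open>\<gamma>\<close>, since it agrees with \<open>inv_into U \<phi>\<close> on the chart
    image.\<close>
  then obtain g where g: "continuous_map (top_of_set (\<phi> ` U)) (subtopology (mtop M) U) g"
    "\<And>y. y \<in> U \<Longrightarrow> g (\<phi> y) = y"
    using openin_subset[OF U(1)]
    by (auto simp: homeomorphic_map_maps homeomorphic_maps_def topspace_subtopology_subset)
  have "continuous_map (top_of_set I) (top_of_set (\<phi> ` U)) \<alpha>"
    using \<alpha>U continuous_on_subset[OF cont] by (simp add: image_subset_iff)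
  then have "continuous_map (top_of_set I) (mtop M) (g \<circ> \<alpha>)"
    using continuous_map_compose g(1) continuous_map_into_fulltopology by blast
  moreover have "(g \<circ> \<alpha>) t = \<gamma> t" if "t \<in> topspace (top_of_set I)" for t
    using that g(2) \<gamma> by (metis comp_apply topspace_euclidean_subtopology)
  ultimately have "continuous_map (top_of_set I) (mtop M) \<gamma>"
    by (rule continuous_map_eq)
  moreover have "smooth_on {t \<in> I. \<gamma> t \<in> V} (\<psi> \<circ> \<gamma>)" if "(V, \<psi>) \<in> atlas M" for V \<psi>
  proof -
    have sm: "smooth_on (\<phi> ` (U \<inter> V)) (\<psi> \<circ> inv_into U \<phi>)"
      using assms(1,2) that unfolding smooth_manifold_def by blast
    have "\<phi> x + t *\<^sub>R v \<in> \<phi> ` (U \<inter> V)" if "t \<in> {t \<in> I. \<gamma> t \<in> V}" for t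
      using \<gamma>[of t] that unfolding \<alpha>_def by (metis IntI image_eqI mem_Collect_eq)
    then have "smooth_on {t \<in> I. \<gamma> t \<in> V} (\<lambda>t. (\<psi> \<circ> inv_into U \<phi>) (\<phi> x + t *\<^sub>R v))"
      by (rule smooth_on_compose_affine[OF bounded_linear_scaleR_left sm])
    then show ?thesis
      by (simp add: \<gamma>_def \<alpha>_def o_def)
  qed
  moreover have "\<gamma> 0 = x"
    using inj assms(3) by (simp add: \<gamma>_def \<alpha>_def)
  ultimately have cur: "curve_at M x \<gamma>"
    unfolding curve_at_def smooth_map_on_real_line_iff using I by blast
  have "(\<alpha> has_vector_derivative v) (at 0)"
    unfolding \<alpha>_def by (auto intro!: derivative_eq_intros)
  then have "((\<lambda>t. \<phi> (\<gamma> t)) has_vector_derivative v) (at 0)"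
    using has_vector_derivative_transform_within_open[OF _ I] \<gamma>(2) by fastforce
  then have "chart_coords \<phi> (velocity M \<gamma>) = v"
    by (rule chart_coords_velocity[OF assms(1-3) cur])
  moreover have "velocity M \<gamma> \<in> tangent_space M x"
    unfolding tangent_space_eq using cur by (blast intro: tvec.span_base)
  ultimately show thesis
    using that by blast
qed

section \<open>The complex structure and (0,1)-vectors in a chart\<close>

lemma chart_coords_transition:
  assumes "complex_manifold M J" "(U, \<phi>) \<in> atlas M" "x \<in> U" "(V, \<psi>) \<in> atlas M" "x \<in> V"
  obtains D where "linear D" "\<And>v. v \<in> mmodel M \<Longrightarrow> D (J v) = J (D v)"
    "\<And>u. u \<in> tangent_space M x \<Longrightarrow> chart_coords \<psi> u = D (chart_coords \<phi> u)"
proof -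
  have M: "smooth_manifold M"
    using assms(1) by (simp add: complex_manifold_def)
  have "holo_on J (mmodel M) J (\<phi> ` (U \<inter> V)) (\<psi> \<circ> inv_into U \<phi>)"
    using assms(1,2,4) unfolding complex_manifold_def by blast
  \<comment> \<open>A derivative within the chart image need not be unique off the model space, so
    the \<open>D\<close> supplied by holomorphy is kept: the same map must commute with
    \<open>J\<close> and transform coordinates.\<close>
  then obtain D where D: "((\<psi> \<circ> inv_into U \<phi>) has_derivative D) (at (\<phi> x) within \<phi> ` (U \<inter> V))"
    "\<And>v. v \<in> mmodel M \<Longrightarrow> D (J v) = J (D v)"
    using assms(3,5) unfolding holo_on_def by blast
  have lin: "linear D"
    using D(1) by (rule has_derivative_linear)
  have "chart_coords \<psi> u = D (chart_coords \<phi> u)" if "u \<in> tangent_space M x" for u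
    using that unfolding tangent_space_eq
  proof (induction rule: tvec.span_induct_alt)
    case base
    show ?case unfolding chart_coords_0 using lin by (simp add: linear_0)
  next
    case (step c v w)
    then obtain \<gamma> where \<gamma>: "v = velocity M \<gamma>" "curve_at M x \<gamma>"
      by blast
    obtain d where d: "((\<lambda>t. \<phi> (\<gamma> t)) has_vector_derivative d) (at 0)"
      using curve_at_derivative[OF M \<gamma>(2) assms(2,3)] by blast
    have "((\<lambda>t. \<psi> (\<gamma> t)) has_vector_derivative D d) (at 0)"
      using chart_openin[OF M] assms(2-5)
      by (intro curve_at_chain[OF \<gamma>(2) _ _ _ chart_inj_on[OF M assms(2)] d D(1)]) auto
    then have "chart_coords \<psi> v = D (chart_coords \<phi> v)"
      using chart_coords_velocity[OF M assms(2,3) \<gamma>(2) d]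
        chart_coords_velocity[OF M assms(4,5) \<gamma>(2)] \<gamma>(1) by simp
    then show ?case
      unfolding chart_coords_add chart_coords_tscale
      using lin step by (simp add: linear_add linear_cmul)
  qed
  then show thesis
    using that D(2) lin by blast
qed

text \<open>The definite description asks for the equation in every chart. Complex linearity of the
  transition derivative reduces this to one chart, where surjectivity of the coordinates gives
  existence and injectivity gives uniqueness.\<close>

lemma tangent_J_eq_iff:
  assumes "complex_manifold M J" "(U, \<phi>) \<in> atlas M" "x \<in> U"
    and u: "u \<in> tangent_space M x" and w: "w \<in> tangent_space M x"
  shows "tangent_J M J x u = w \<longleftrightarrow> chart_coords \<phi> w = J (chart_coords \<phi> u)"
proof -
  have M: "smooth_manifold M" and J: "\<And>v. v \<in> mmodel M \<Longrightarrow> J v \<in> mmodel M"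
    using assms(1) by (auto simp: complex_manifold_def)
  have char: "(\<forall>(V, \<psi>)\<in>atlas M. x \<in> V \<longrightarrow> chart_coords \<psi> z = J (chart_coords \<psi> u)) \<longleftrightarrow>
      chart_coords \<phi> z = J (chart_coords \<phi> u)" if z: "z \<in> tangent_space M x" for z
  proof
    assume *: "chart_coords \<phi> z = J (chart_coords \<phi> u)"
    have "chart_coords \<psi> z = J (chart_coords \<psi> u)" if V: "(V, \<psi>) \<in> atlas M" "x \<in> V" for V \<psi>
    proof -
      obtain D where D: "linear D" "\<And>v. v \<in> mmodel M \<Longrightarrow> D (J v) = J (D v)"
        "\<And>u. u \<in> tangent_space M x \<Longrightarrow> chart_coords \<psi> u = D (chart_coords \<phi> u)"
        by (rule chart_coords_transition[OF assms(1-3) V]) (rule that; assumption)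
      show ?thesis
        using * D(2)[OF chart_coords_in_model[OF M assms(2,3) u]] D(3)[OF u] D(3)[OF z] by simp
    qed
    then show "\<forall>(V, \<psi>)\<in>atlas M. x \<in> V \<longrightarrow> chart_coords \<psi> z = J (chart_coords \<psi> u)"
      by blast
  qed (use assms(2,3) in blast)
  obtain z where z: "z \<in> tangent_space M x" "chart_coords \<phi> z = J (chart_coords \<phi> u)"
    by (rule chart_coords_surj[OF M assms(2,3) J[OF chart_coords_in_model[OF M assms(2,3) u]]])
  have uniq: "z' = z" if "z' \<in> tangent_space M x" "chart_coords \<phi> z' = J (chart_coords \<phi> u)" for z'
    by (rule inj_onD[OF chart_coords_inj[OF M assms(2,3)] _ that(1) z(1)]) (simp add: that(2) z(2))
  have "tangent_J M J x u = z"
    unfolding tangent_J_def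
  proof (rule the_equality)
    show "z \<in> tangent_space M x \<and> (\<forall>(V, \<psi>)\<in>atlas M. x \<in> V \<longrightarrow> chart_coords \<psi> z = J (chart_coords \<psi> u))"
      using z char[OF z(1)] by simp
  next
    fix z' assume "z' \<in> tangent_space M x \<and>
      (\<forall>(V, \<psi>)\<in>atlas M. x \<in> V \<longrightarrow> chart_coords \<psi> z' = J (chart_coords \<psi> u))"
    then show "z' = z"
      using char[of z'] uniq[of z'] by blast
  qed
  then show ?thesis
    using z(2) uniq[OF w] by blast
qed

text \<open>Evaluated on a real-valued smooth \<open>f\<close>, the complex vector returns
  \<open>Complex (u f) (w f)\<close>, so \<open>u\<close> and \<open>w\<close> can be read
  off.\<close>

lemma cplx_add_i_inj:
  fixes M :: "('m, 'a::euclidean_space) manifold"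
  assumes "cplx M x u + tscale \<i> (cplx M x w) = cplx M x u' + tscale \<i> (cplx M x w')"
    and mem: "u \<in> tangent_space M x" "w \<in> tangent_space M x" "u' \<in> tangent_space M x" "w' \<in> tangent_space M x"
  shows "u = u' \<and> w = w'"
proof -
  have const: "vector_derivative (\<lambda>t::real. 0::real) (at 0) = 0"
    by (rule vector_derivative_at[OF has_vector_derivative_const])
  \<comment> \<open>The imaginary part of a real-valued function is the zero function; this makes
    its contribution to \<open>cplx\<close> vanish.\<close>
  have zero: "v (\<lambda>_. 0) = 0" if "v \<in> tangent_space M x" for v :: "('m, real) tvec"
    using that unfolding tangent_space_eq
    by (induction rule: tvec.span_induct_alt) (auto simp: velocity_def tscale_def const split: if_splits)
  have eval: "(cplx M x v + tscale \<i> (cplx M x z)) (\<lambda>y. of_real (f y)) = Complex (v f) (z f)"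
    if "smooth_near M x f" "v \<in> tangent_space M x" "z \<in> tangent_space M x" for v z f
  proof -
    have "smooth_near M x (\<lambda>y. complex_of_real (f y))"
      using smooth_near_linear_compose[OF bounded_linear_of_real that(1)] .
    then show ?thesis
      by (simp add: cplx_def tscale_def zero that complex_eq_iff)
  qed
  have "u f = u' f \<and> w f = w' f" for f
  proof (cases "smooth_near M x f")
    case True
    then show ?thesis
      using eval[OF True mem(1,2)] eval[OF True mem(3,4)] unfolding assms(1) by simp
  next
    case False
    then show ?thesis
      using mem tangent_eq_0 by metis
  qed
  then show ?thesis
    by (simp add: fun_eq_iff)
qed

text \<open>Membership in \<open>T01\<close> only asserts that some decomposition satisfies the two
  equations; by \<open>cplx_add_i_inj\<close> it is the given one.\<close>

lemma T01_iff:
  assumes "complex_manifold M J" "(U, \<phi>) \<in> atlas M" "x \<in> U"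
    and u: "u \<in> tangent_space M x" and w: "w \<in> tangent_space M x"
  shows "cplx M x u + tscale \<i> (cplx M x w) \<in> T01 M J x \<longleftrightarrow> chart_coords \<phi> w = J (chart_coords \<phi> u)"
proof -
  have M: "smooth_manifold M" and J: "\<And>v. v \<in> mmodel M \<Longrightarrow> J (J v) = - v"
    using assms(1) by (auto simp: complex_manifold_def)
  have neg: "- u \<in> tangent_space M x"
    by (rule tvec.subspace_neg[OF tangent_space_subspace u])
  have cneg: "chart_coords \<phi> (- u) = - chart_coords \<phi> u"
    by (simp add: chart_coords_def sum_negf)
  have "cplx M x u + tscale \<i> (cplx M x w) \<in> T01 M J x \<longleftrightarrow>
      tangent_J M J x u = w \<and> tangent_J M J x w = - u"
  proof
    assume "cplx M x u + tscale \<i> (cplx M x w) \<in> T01 M J x"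
    then obtain u' w' where *: "cplx M x u + tscale \<i> (cplx M x w) = cplx M x u' + tscale \<i> (cplx M x w')"
      "u' \<in> tangent_space M x" "w' \<in> tangent_space M x" "tangent_J M J x u' = w'" "tangent_J M J x w' = - u'"
      unfolding T01_def mem_Collect_eq by (elim exE conjE) (rule that; assumption)
    then show "tangent_J M J x u = w \<and> tangent_J M J x w = - u"
      using cplx_add_i_inj[OF *(1) u w *(2,3)] by simp
  next
    assume "tangent_J M J x u = w \<and> tangent_J M J x w = - u"
    then show "cplx M x u + tscale \<i> (cplx M x w) \<in> T01 M J x"
      unfolding T01_def mem_Collect_eq using u w by (intro exI[of _ u] exI[of _ w]) simp
  qed
  \<comment> \<open>The equation J w = - u follows from J u = w because J squares to -1 on the model
    space.\<close>
  also have "\<dots> \<longleftrightarrow> chart_coords \<phi> w = J (chart_coords \<phi> u)"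
    using tangent_J_eq_iff[OF assms(1-3) u w] tangent_J_eq_iff[OF assms(1-3) w neg] cneg
      J chart_coords_in_model[OF M assms(2,3) u] by auto
  finally show ?thesis .
qed

section \<open>Linear algebra of a fibre\<close>

lemma (in module) span_family:
  assumes "finite I"
  shows "span (e ` I) = range (\<lambda>c. \<Sum>i\<in>I. scale (c i) (e i))"
proof
  show "span (e ` I) \<subseteq> range (\<lambda>c. \<Sum>i\<in>I. scale (c i) (e i))"
  proof (rule span_minimal)
    show "e ` I \<subseteq> range (\<lambda>c. \<Sum>i\<in>I. scale (c i) (e i))"
    proof
      fix v assume "v \<in> e ` I"
      then obtain j where j: "j \<in> I" "v = e j" by blast
      have "(\<Sum>i\<in>I. scale (if i = j then 1 else 0) (e i)) = (\<Sum>i\<in>I. if i = j then e j else 0)"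
        by (intro sum.cong) auto
      also have "\<dots> = v"
        using assms j by simp
      finally show "v \<in> range (\<lambda>c. \<Sum>i\<in>I. scale (c i) (e i))"
        by (rule range_eqI[where x = "\<lambda>i. if i = j then 1 else 0", OF sym])
    qed
    show "subspace (range (\<lambda>c. \<Sum>i\<in>I. scale (c i) (e i)))"
    proof (rule subspaceI)
      show "0 \<in> range (\<lambda>c. \<Sum>i\<in>I. scale (c i) (e i))"
        by (rule range_eqI[of _ _ "\<lambda>_. 0"]) simp
    next
      fix v w assume "v \<in> range (\<lambda>c. \<Sum>i\<in>I. scale (c i) (e i))" "w \<in> range (\<lambda>c. \<Sum>i\<in>I. scale (c i) (e i))"
      then obtain c d where "v = (\<Sum>i\<in>I. scale (c i) (e i))" "w = (\<Sum>i\<in>I. scale (d i) (e i))" by blast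
      then show "v + w \<in> range (\<lambda>c. \<Sum>i\<in>I. scale (c i) (e i))"
        by (intro range_eqI[of _ _ "\<lambda>i. c i + d i"]) (simp add: scale_left_distrib sum.distrib)
    next
      fix a v assume "v \<in> range (\<lambda>c. \<Sum>i\<in>I. scale (c i) (e i))"
      then obtain c where "v = (\<Sum>i\<in>I. scale (c i) (e i))" by blast
      then show "scale a v \<in> range (\<lambda>c. \<Sum>i\<in>I. scale (c i) (e i))"
        by (intro range_eqI[of _ _ "\<lambda>i. a * c i"]) (simp add: scale_sum_right)
    qed
  qed
  show "range (\<lambda>c. \<Sum>i\<in>I. scale (c i) (e i)) \<subseteq> span (e ` I)"
  proof (rule image_subsetI)
    show "(\<Sum>i\<in>I. scale (c i) (e i)) \<in> span (e ` I)" for c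
      by (rule span_sum) (auto intro: span_scale span_base)
  qed
qed

text \<open>The image set forgets repetitions, so independence of an indexed family is injectivity
  together with independence of the image. The coefficient criterion captures both at once, matching
  the two clauses of \<open>frame_on\<close>.\<close>

lemma (in vector_space) independent_family_iff:
  assumes "finite I"
  shows "inj_on e I \<and> independent (e ` I) \<longleftrightarrow> (\<forall>c. (\<Sum>i\<in>I. scale (c i) (e i)) = 0 \<longrightarrow> (\<forall>i\<in>I. c i = 0))"
proof
  assume e: "inj_on e I \<and> independent (e ` I)"
  show "\<forall>c. (\<Sum>i\<in>I. scale (c i) (e i)) = 0 \<longrightarrow> (\<forall>i\<in>I. c i = 0)"
  proof (intro allI impI ballI)
    fix c i assume c: "(\<Sum>i\<in>I. scale (c i) (e i)) = 0" and i: "i \<in> I"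
    let ?c = "\<lambda>v. c (inv_into I e v)"
    have "(\<Sum>v\<in>e ` I. scale (?c v) v) = (\<Sum>i\<in>I. scale (c i) (e i))"
      using e by (simp add: sum.reindex)
    then have "(\<Sum>v\<in>e ` I. scale (?c v) v) = 0"
      using c by simp
    then have "?c (e i) = 0"
      using e i assms by (intro independentD[of "e ` I" "e ` I" ?c]) auto
    then show "c i = 0"
      using e i by simp
  qed
next
  assume *: "\<forall>c. (\<Sum>i\<in>I. scale (c i) (e i)) = 0 \<longrightarrow> (\<forall>i\<in>I. c i = 0)"
  have inj: "inj_on e I"
  proof (rule inj_onI, rule ccontr)
    fix i j assume ij: "i \<in> I" "j \<in> I" "e i = e j" "i \<noteq> j"
    let ?c = "\<lambda>k. (if k = i then 1 else 0) - (if k = j then 1 else 0) :: 'a"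
    have "(\<Sum>k\<in>I. scale (?c k) (e k)) = (\<Sum>k\<in>I. if k = i then e i else 0) - (\<Sum>k\<in>I. if k = j then e j else 0)"
      unfolding sum_subtractf[symmetric] by (intro sum.cong) (auto simp: scale_left_diff_distrib)
    then have "(\<Sum>k\<in>I. scale (?c k) (e k)) = 0"
      using ij assms by simp
    then have "?c i = 0"
      using *[rule_format, of ?c i] ij(1) by blast
    then show False
      using ij by simp
  qed
  have "independent (e ` I)"
  proof
    assume "dependent (e ` I)"
    then obtain u v where u: "v \<in> e ` I" "u v \<noteq> 0" "(\<Sum>v\<in>e ` I. scale (u v) v) = 0"
      using dependent_finite[of "e ` I"] assms by auto
    then have "(\<Sum>i\<in>I. scale (u (e i)) (e i)) = 0"
      using inj by (simp add: sum.reindex)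
    then show False
      using *[rule_format, of "\<lambda>i. u (e i)"] u by auto
  qed
  with inj show "inj_on e I \<and> independent (e ` I)" by simp
qed

text \<open>An injective linear map carries a frame to a basis of its image. \<open>T\<close> is
  linear on \<open>S\<close> only, as the anchor is on a fibre, so additivity and homogeneity appear
  as relative hypotheses. The lemma serves to compare the rank of the real parts with the dimension
  of the model space.\<close>

lemma dim_eq_of_frame:
  fixes T :: "'v::ab_group_add \<Rightarrow> 'a::euclidean_space" and f :: "nat \<Rightarrow> 'v"
  assumes "vector_space s"
    and f: "inj_on f {..<n}" "\<not> module.dependent s (f ` {..<n})" "module.span s (f ` {..<n}) = S"
    and T: "\<And>v w. v \<in> S \<Longrightarrow> w \<in> S \<Longrightarrow> T (v + w) = T v + T w"
      "\<And>c v. v \<in> S \<Longrightarrow> T (s c v) = c *\<^sub>R T v" "T ` S = V" "\<And>v. v \<in> S \<Longrightarrow> T v = 0 \<Longrightarrow> v = 0"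
  shows "dim V = n"
proof -
  interpret S: vector_space s by fact
  have sub: "S.subspace S"
    using f(3) by auto
  have T0: "T 0 = 0"
    using T(2)[of 0 0] S.subspace_0[OF sub] by simp
  have fS: "s c (f i) \<in> S" if "i < n" for c i
    using that f(3) by (auto intro: S.span_scale S.span_base)
  have sum: "T (\<Sum>i\<in>I. s (c i) (f i)) = (\<Sum>i\<in>I. c i *\<^sub>R T (f i))" if "I \<subseteq> {..<n}" for I c
  proof -
    have "finite I"
      using that finite_subset by blast
    then show ?thesis
      using that
    proof (induction I)
      case (insert i I)
      have "(\<Sum>i\<in>I. s (c i) (f i)) \<in> S"
        using insert.prems fS by (auto intro!: S.subspace_sum[OF sub])
      moreover have "f i \<in> S"
        using fS[of i 1] insert.prems by simp
      ultimately show ?case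
        using insert T fS[of i "c i"] by auto
    qed (simp add: T0)
  qed
  have "inj_on (\<lambda>i. T (f i)) {..<n} \<and> independent ((\<lambda>i. T (f i)) ` {..<n})"
    unfolding real_vector.independent_family_iff[OF finite_lessThan]
  proof (intro allI impI)
    fix c assume "(\<Sum>i<n. c i *\<^sub>R T (f i)) = 0"
    then have "T (\<Sum>i<n. s (c i) (f i)) = 0"
      by (simp add: sum)
    moreover have "(\<Sum>i<n. s (c i) (f i)) \<in> S"
      using fS by (auto intro!: S.subspace_sum[OF sub])
    ultimately have "(\<Sum>i<n. s (c i) (f i)) = 0"
      using T(4) by blast
    then show "\<forall>i\<in>{..<n}. c i = 0"
      using f S.independent_family_iff[of "{..<n}" f] by blast
  qed
  then have ind: "inj_on (\<lambda>i. T (f i)) {..<n}" "independent ((\<lambda>i. T (f i)) ` {..<n})"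
    by blast+
  have "span ((\<lambda>i. T (f i)) ` {..<n}) = V"
    unfolding real_vector.span_family[OF finite_lessThan] T(3)[symmetric] f(3)[symmetric]
      S.span_family[OF finite_lessThan] image_image by (simp add: sum)
  then have "dim V = dim ((\<lambda>i. T (f i)) ` {..<n})"
    by (metis dim_span)
  also have "\<dots> = n"
    unfolding dim_eq_card_independent[OF ind(2)] card_image[OF ind(1)] by simp
  finally show ?thesis .
qed

section \<open>Real forms of complex vector spaces and real parts of complex subspaces\<close>

locale real_form = vector_space scale
  for scale :: "complex \<Rightarrow> 'v::ab_group_add \<Rightarrow> 'v" (infixr \<open>\<odot>\<close> 75) +
  fixes R :: "'v set"
  assumes R_0: "0 \<in> R"
    and R_add: "a \<in> R \<Longrightarrow> b \<in> R \<Longrightarrow> a + b \<in> R"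
    and R_scale: "a \<in> R \<Longrightarrow> of_real c \<odot> a \<in> R"
    and R_unique: "\<lbrakk>a \<in> R; b \<in> R; a' \<in> R; b' \<in> R; a + \<i> \<odot> b = a' + \<i> \<odot> b'\<rbrakk> \<Longrightarrow> a = a' \<and> b = b'"
begin

lemma R_neg: "a \<in> R \<Longrightarrow> - a \<in> R"
  using R_scale[of a "-1"] by simp

lemma R_diff: "a \<in> R \<Longrightarrow> b \<in> R \<Longrightarrow> a - b \<in> R"
  using R_add[of a "- b"] R_neg by simp

lemma R_sum: "(\<And>i. i \<in> I \<Longrightarrow> a i \<in> R) \<Longrightarrow> sum a I \<in> R"
  by (induction I rule: infinite_finite_induct) (auto simp: R_0 R_add)

definition re_part :: "'v set \<Rightarrow> 'v set" where
  "re_part L = {a \<in> R. \<exists>b\<in>R. a + \<i> \<odot> b \<in> L}"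

lemma complex_scale: "z \<odot> (a + \<i> \<odot> b) =
    (of_real (Re z) \<odot> a - of_real (Im z) \<odot> b) + \<i> \<odot> (of_real (Re z) \<odot> b + of_real (Im z) \<odot> a)"
proof -
  have z: "z = of_real (Re z) + \<i> * of_real (Im z)"
    by (simp add: complex_eq_iff)
  show ?thesis
    by (subst z) (simp add: algebra_simps)
qed

lemma real_scale: "vector_space (\<lambda>c. scale (of_real c) :: 'v \<Rightarrow> 'v)"
  by standard (auto simp: algebra_simps)

sublocale real: vector_space "\<lambda>c. scale (complex_of_real c)"
  by (rule real_scale)

lemma re_partI:
  assumes "subspace L" "a + \<i> \<odot> b \<in> L" "a \<in> R" "b \<in> R"
  shows "a \<in> re_part L" "b \<in> re_part L"
proof -
  \<comment> \<open>The factor is -\<i> rather than \<i>, so that \<open>b\<close> itself and not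
    its negative becomes the real part.\<close>
  have eq: "(- \<i>) \<odot> (a + \<i> \<odot> b) = b + \<i> \<odot> (- a)"
    by (simp add: complex_scale)
  have "b + \<i> \<odot> (- a) \<in> L"
    unfolding eq[symmetric] by (rule subspace_scale[OF assms(1,2)])
  then show "a \<in> re_part L" "b \<in> re_part L"
    using assms R_neg unfolding re_part_def by blast+
qed

lemma re_part_subspace:
  assumes "subspace L"
  shows "real.subspace (re_part L)"
proof (rule real.subspaceI)
  show "0 \<in> re_part L"
    using R_0 subspace_0[OF assms] by (auto simp: re_part_def intro!: bexI[of _ 0])
next
  fix a a' assume "a \<in> re_part L" "a' \<in> re_part L"
  then obtain b b' where b: "a \<in> R" "b \<in> R" "a' \<in> R" "b' \<in> R" "a + \<i> \<odot> b \<in> L" "a' + \<i> \<odot> b' \<in> L"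
    unfolding re_part_def by blast
  have eq: "(a + \<i> \<odot> b) + (a' + \<i> \<odot> b') = (a + a') + \<i> \<odot> (b + b')"
    by (simp add: algebra_simps)
  have "(a + a') + \<i> \<odot> (b + b') \<in> L"
    unfolding eq[symmetric] by (rule subspace_add[OF assms b(5,6)])
  then show "a + a' \<in> re_part L"
    using re_partI(1)[OF assms] b R_add by blast
next
  fix c a assume "a \<in> re_part L"
  then obtain b where b: "a \<in> R" "b \<in> R" "a + \<i> \<odot> b \<in> L"
    unfolding re_part_def by blast
  have eq: "of_real c \<odot> (a + \<i> \<odot> b) = of_real c \<odot> a + \<i> \<odot> (of_real c \<odot> b)"
    by (simp add: complex_scale)
  have "of_real c \<odot> a + \<i> \<odot> (of_real c \<odot> b) \<in> L"
    unfolding eq[symmetric] by (rule subspace_scale[OF assms b(3)])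
  then show "of_real c \<odot> a \<in> re_part L"
    using re_partI(1)[OF assms] b R_scale by blast
qed

lemma sum_double:
  fixes g :: "nat \<Rightarrow> 'v"
  shows "(\<Sum>k<2 * r. g k) = (\<Sum>j<r. g j) + (\<Sum>j<r. g (r + j))"
proof -
  have "(\<Sum>k<2 * r. g k) = (\<Sum>k\<in>{..<r}. g k) + (\<Sum>k\<in>{r..<r + r}. g k)"
    by (subst sum.union_disjoint[symmetric]) (auto intro!: sum.cong)
  also have "(\<Sum>k\<in>{r..<r + r}. g k) = (\<Sum>j<r. g (r + j))"
    using sum.shift_bounds_nat_ivl[of g 0 r r] by (simp add: add.commute lessThan_atLeast0)
  finally show ?thesis .
qed

text \<open>A real relation among the a_j and b_j says that the real part of a complex combination
  of the e_j vanishes. What is left is \<i> w in \<open>L\<close> with \<open>w\<close> in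
  \<open>R\<close>; by \<open>im\<close> it is 0, and independence of the e_j applies. For the span,
  an element of \<open>L\<close> is expanded in the e_j and real parts are compared.\<close>

lemma re_part_frame:
  fixes a b :: "nat \<Rightarrow> 'v" and r :: nat
  defines "e \<equiv> \<lambda>j. a j + \<i> \<odot> b j" and "f \<equiv> \<lambda>k. if k < r then a k else b (k - r)"
  assumes R: "\<And>j. j < r \<Longrightarrow> a j \<in> R" "\<And>j. j < r \<Longrightarrow> b j \<in> R"
    and e: "inj_on e {..<r}" "independent (e ` {..<r})" "span (e ` {..<r}) = L"
    and im: "\<And>b. b \<in> R \<Longrightarrow> \<i> \<odot> b \<in> L \<Longrightarrow> b = 0"
  shows "inj_on f {..<2 * r}" "real.independent (f ` {..<2 * r})" "real.span (f ` {..<2 * r}) = re_part L"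
proof -
  have L: "subspace L"
    using e(3) by auto
  have fsum: "(\<Sum>k<2 * r. of_real (c k) \<odot> f k) =
      (\<Sum>j<r. of_real (c j) \<odot> a j + of_real (c (r + j)) \<odot> b j)" for c
    unfolding sum_double sum.distrib by (simp add: f_def)
  have esum: "(\<Sum>j<r. z j \<odot> e j) = (\<Sum>j<r. of_real (Re (z j)) \<odot> a j - of_real (Im (z j)) \<odot> b j) +
      \<i> \<odot> (\<Sum>j<r. of_real (Re (z j)) \<odot> b j + of_real (Im (z j)) \<odot> a j)" for z
    by (simp only: e_def complex_scale scale_sum_right) (rule sum.distrib)
  have eL: "(\<Sum>j<r. z j \<odot> e j) \<in> L" for z
    unfolding e(3)[symmetric] by (rule span_sum) (auto intro: span_scale span_base)
  have "\<forall>c. (\<Sum>k<2 * r. of_real (c k) \<odot> f k) = 0 \<longrightarrow> (\<forall>k\<in>{..<2 * r}. c k = 0)"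
  proof (intro allI impI)
    fix c assume c: "(\<Sum>k<2 * r. of_real (c k) \<odot> f k) = 0"
    \<comment> \<open>The real part of z (a + \<i> b) is Re z a - Im z b, hence the minus sign. The
      same sign reappears in the coefficients of the spanning argument.\<close>
    define z where "z j = Complex (c j) (- c (r + j))" for j
    define w where "w = (\<Sum>j<r. of_real (Re (z j)) \<odot> b j + of_real (Im (z j)) \<odot> a j)"
    have "(\<Sum>j<r. z j \<odot> e j) = \<i> \<odot> w"
      using c unfolding esum fsum w_def by (simp add: z_def)
    moreover have "w \<in> R"
      unfolding w_def using R by (intro R_sum R_add R_scale) auto
    ultimately have "(\<Sum>j<r. z j \<odot> e j) = 0"
      using im[of w] eL[of z] by simp
    then have "\<forall>j\<in>{..<r}. z j = 0"
      using independent_family_iff[of "{..<r}" e] e(1,2) by blast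
    then have *: "c j = 0" "c (r + j) = 0" if "j < r" for j
      using that by (auto simp: z_def complex_eq_iff)
    show "\<forall>k\<in>{..<2 * r}. c k = 0"
    proof
      fix k assume "k \<in> {..<2 * r}"
      then show "c k = 0"
        using *(1)[of k] *(2)[of "k - r"] by (cases "k < r") auto
    qed
  qed
  then show "inj_on f {..<2 * r}" "real.independent (f ` {..<2 * r})"
    using real.independent_family_iff[of "{..<2 * r}" f] by blast+
  show "real.span (f ` {..<2 * r}) = re_part L"
  proof
    have "f k \<in> re_part L" if "k < 2 * r" for k
    proof -
      have "e j \<in> L" if "j < r" for j
        using e(3) that by (auto intro: span_base)
      then have "a j \<in> re_part L" "b j \<in> re_part L" if "j < r" for j
        using re_partI[OF L, of "a j" "b j"] R that by (auto simp: e_def)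
      then show ?thesis
        using that by (auto simp: f_def)
    qed
    then show "real.span (f ` {..<2 * r}) \<subseteq> re_part L"
      by (intro real.span_minimal re_part_subspace L) auto
  next
    show "re_part L \<subseteq> real.span (f ` {..<2 * r})"
    proof
      fix v assume "v \<in> re_part L"
      then obtain w where w: "v \<in> R" "w \<in> R" "v + \<i> \<odot> w \<in> L"
        unfolding re_part_def by blast
      then obtain z where z: "v + \<i> \<odot> w = (\<Sum>j<r. z j \<odot> e j)"
        unfolding e(3)[symmetric] span_family[OF finite_lessThan] by blast
      have "v = (\<Sum>j<r. of_real (Re (z j)) \<odot> a j - of_real (Im (z j)) \<odot> b j)"
      proof (rule conjunct1[OF R_unique[OF w(1,2) _ _ z[unfolded esum]]])
        show "(\<Sum>j<r. of_real (Re (z j)) \<odot> a j - of_real (Im (z j)) \<odot> b j) \<in> R"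
          using R by (intro R_sum R_diff R_scale) auto
        show "(\<Sum>j<r. of_real (Re (z j)) \<odot> b j + of_real (Im (z j)) \<odot> a j) \<in> R"
          using R by (intro R_sum R_add R_scale) auto
      qed
      also have "\<dots> = (\<Sum>k<2 * r. of_real (if k < r then Re (z k) else - Im (z (k - r))) \<odot> f k)"
        unfolding fsum by (intro sum.cong) auto
      also have "\<dots> \<in> real.span (f ` {..<2 * r})"
        unfolding real.span_family[OF finite_lessThan] by (rule rangeI)
      finally show "v \<in> real.span (f ` {..<2 * r})" .
    qed
  qed
qed

end

text \<open>The situation in one fibre: \<open>T\<close> is the real anchor, read in a chart with model space \<open>V\<close>, so
  that \<open>L\<close> projects onto the graph of the complex structure \<open>J\<close>.\<close>

locale chern_fibre = real_form scale R
  for scale :: "complex \<Rightarrow> 'v::ab_group_add \<Rightarrow> 'v" (infixr \<open>\<odot>\<close> 75) and R :: "'v set" +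
  fixes L :: "'v set" and T :: "'v \<Rightarrow> 'a::euclidean_space" and V :: "'a set" and J :: "'a \<Rightarrow> 'a"
  assumes L_subspace: "subspace L"
    and L_decomp: "e \<in> L \<Longrightarrow> \<exists>a\<in>R. \<exists>b\<in>R. e = a + \<i> \<odot> b"
    and T_add: "a \<in> R \<Longrightarrow> b \<in> R \<Longrightarrow> T (a + b) = T a + T b"
    and T_scale: "a \<in> R \<Longrightarrow> T (of_real c \<odot> a) = c *\<^sub>R T a"
    and T_in: "a \<in> R \<Longrightarrow> T a \<in> V"
    and L_graph: "\<lbrakk>a \<in> R; b \<in> R; a + \<i> \<odot> b \<in> L\<rbrakk> \<Longrightarrow> T b = J (T a)"
    and L_inj: "\<lbrakk>a \<in> R; b \<in> R; a + \<i> \<odot> b \<in> L; T a = 0\<rbrakk> \<Longrightarrow> a = 0 \<and> b = 0"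
    and L_surj: "v \<in> V \<Longrightarrow> \<exists>a\<in>R. \<exists>b\<in>R. a + \<i> \<odot> b \<in> L \<and> T a = v"
begin

lemma T_0: "T 0 = 0"
  using T_scale[OF R_0, of 0] by simp

lemma T_diff: "a \<in> R \<Longrightarrow> b \<in> R \<Longrightarrow> T (a - b) = T a - T b"
  using T_add[of "a - b" b] R_diff by simp

lemma re_part_inj: "a \<in> re_part L \<Longrightarrow> T a = 0 \<Longrightarrow> a = 0"
  using L_inj unfolding re_part_def by blast

lemma T_image_re_part: "T ` re_part L = V"
  using T_in L_surj unfolding re_part_def by fast

lemma L_eq_re_part: "L = {a + \<i> \<odot> b | a b. a \<in> re_part L \<and> b \<in> re_part L \<and> T b = J (T a)}"
proof (intro equalityI subsetI)
  fix e assume e: "e \<in> L"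
  then obtain a b where ab: "a \<in> R" "b \<in> R" "e = a + \<i> \<odot> b"
    using L_decomp by blast
  then have "a \<in> re_part L" "b \<in> re_part L" "T b = J (T a)"
    using e re_partI[OF L_subspace] L_graph by blast+
  then show "e \<in> {a + \<i> \<odot> b | a b. a \<in> re_part L \<and> b \<in> re_part L \<and> T b = J (T a)}"
    using ab(3) by blast
next
  fix e assume "e \<in> {a + \<i> \<odot> b | a b. a \<in> re_part L \<and> b \<in> re_part L \<and> T b = J (T a)}"
  then obtain a b where ab: "e = a + \<i> \<odot> b" "a \<in> re_part L" "b \<in> re_part L" "T b = J (T a)"
    by blast
  then obtain b' where b': "a \<in> R" "b \<in> R" "b' \<in> R" "a + \<i> \<odot> b' \<in> L"
    unfolding re_part_def by blast
  \<comment> \<open>Both \<open>b\<close> and the partner \<open>b'\<close> of \<open>a\<close> in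
    \<open>L\<close> have anchor J (T a). Their difference is again a real part of \<open>L\<close>,
    where \<open>T\<close> is injective.\<close>
  then have "T (b - b') = 0"
    using L_graph[OF b'(1,3,4)] ab(4) T_diff by simp
  moreover have "b - b' \<in> re_part L"
    using real.subspace_diff[OF re_part_subspace[OF L_subspace] ab(3)] re_partI(2)[OF L_subspace b'(4,1,3)] .
  ultimately have "b = b'"
    using re_part_inj by fastforce
  then show "e \<in> L"
    using ab(1) b'(4) by simp
qed

text \<open>\<open>T\<close> already maps \<open>re_part L\<close> onto the model space, so each
  element of \<open>W\<close> shares its image with an element of \<open>re_part L\<close>. As
  \<open>re_part L\<close> lies in \<open>W\<close>, their difference is in \<open>W\<close> and is
  killed by \<open>T\<close>. This replaces a count of dimensions.\<close>

lemma re_part_unique: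
  assumes W: "W \<subseteq> R" "\<And>a b. a \<in> W \<Longrightarrow> b \<in> W \<Longrightarrow> a - b \<in> W" "\<And>a. a \<in> W \<Longrightarrow> T a = 0 \<Longrightarrow> a = 0"
    and L: "L \<subseteq> {a + \<i> \<odot> b | a b. a \<in> W \<and> b \<in> W}"
  shows "W = re_part L"
proof -
  have sub: "re_part L \<subseteq> W"
  proof
    fix a assume "a \<in> re_part L"
    then obtain b where b: "a \<in> R" "b \<in> R" "a + \<i> \<odot> b \<in> L"
      unfolding re_part_def by blast
    then obtain a' b' where "a' \<in> W" "b' \<in> W" "a + \<i> \<odot> b = a' + \<i> \<odot> b'"
      using L by blast
    then show "a \<in> W"
      using R_unique[OF b(1,2)] W(1) by blast
  qed
  have "a \<in> re_part L" if a: "a \<in> W" for a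
  proof -
    have "T a \<in> T ` re_part L"
      using T_image_re_part T_in a W(1) by blast
    then obtain a' where a': "a' \<in> re_part L" "T a = T a'"
      by blast
    then have "T (a - a') = 0"
      using T_diff a W(1) by (auto simp: re_part_def)
    then have "a - a' = 0"
      using W(2,3) a a'(1) sub by blast
    then show ?thesis
      using a'(1) by simp
  qed
  then show ?thesis
    using sub by blast
qed

text \<open>The case of zero real part in \<open>L_inj\<close>; it provides the hypothesis
  \<open>im\<close> of \<open>re_part_frame\<close>.\<close>

lemma im_eq_0: "b \<in> R \<Longrightarrow> \<i> \<odot> b \<in> L \<Longrightarrow> b = 0"
  using L_inj[OF R_0, of b] T_0 by simp

end

section \<open>Sections and fibres of bundles\<close>

lemma smooth_section_cong:
  assumes "smooth_section X B S s" "\<And>x. x \<in> S \<Longrightarrow> s x = t x"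
  shows "smooth_section X B S t"
  using assms(1) unfolding smooth_section_def by (simp add: assms(2)[symmetric])

lemma subbundle_fibre_subspace:
  assumes "vector_space (scal B)" "subbundle X B F r" "x \<in> mcarrier X"
  shows "module.subspace (scal B) (F `` {x})"
proof -
  interpret vector_space "scal B" by fact
  obtain U e where "x \<in> U" "frame_on B F r U e"
    using assms(2,3) unfolding subbundle_def by meson
  then have "span ((\<lambda>i. e i x) ` {..<r}) = F `` {x}"
    unfolding frame_on_def by blast
  then show ?thesis
    using subspace_span[of "(\<lambda>i. e i x) ` {..<r}"] by simp
qed

lemma vector_bundle_subbundle:
  assumes "vector_bundle X B"
  shows "subbundle X B (total B) (vrank B)"
  using assms unfolding vector_bundle_def subbundle_def by blast

section \<open>The Chern correspondence\<close>

text \<open>Gathers the bundle and anchor axioms of both algebroids and the complexification clauses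
  of a compact form, so that the argument runs without the parameters of the principal
  bundles.\<close>

locale real_courant_form =
  fixes X :: "('x, 'a::euclidean_space) manifold" and J :: "'a \<Rightarrow> 'a"
    and E :: "('x, 'v::ab_group_add, complex) courant" and ER :: "('x, 'v, real) courant"
  assumes complex_manifold: "complex_manifold X J"
    and E: "vector_bundle X E" "anchor_map X E"
    and ER: "vector_bundle X ER" "anchor_map X ER"
    and total_ER: "total ER \<subseteq> total E"
    and scal_ER: "\<And>c v. scal ER c v = scal E (of_real c) v"
    and decomp: "\<forall>(x, e)\<in>total E. \<exists>!(a, b). (x, a) \<in> total ER \<and> (x, b) \<in> total ER \<and> e = a + scal E \<i> b"
    and smooth_section_iff: "\<And>U a b. openin (mtop X) U \<Longrightarrow> \<forall>x\<in>U. (x, a x) \<in> total ER \<and> (x, b x) \<in> total ER \<Longrightarrow>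
      smooth_section X E U (\<lambda>x. a x + scal E \<i> (b x)) \<longleftrightarrow> smooth_section X ER U a \<and> smooth_section X ER U b"
    and anchor_ER: "\<And>x v. x \<in> mcarrier X \<Longrightarrow> (x, v) \<in> total ER \<Longrightarrow> anchor E x v = cplx X x (anchor ER x v)"
begin

lemma smooth_manifold: "smooth_manifold X"
  using complex_manifold by (simp add: complex_manifold_def)

lemma vector_space_E: "vector_space (scal E)" and vector_space_ER: "vector_space (scal ER)"
  using E(1) ER(1) by (simp_all add: vector_bundle_def)

sublocale E: vector_space "scal E"
  by (rule vector_space_E)

sublocale ER: vector_space "scal ER"
  by (rule vector_space_ER)

lemma fibre_subspace:
  assumes "x \<in> mcarrier X"
  shows "E.subspace (total E `` {x})" "ER.subspace (total ER `` {x})"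
  using subbundle_fibre_subspace[OF vector_space_E vector_bundle_subbundle[OF E(1)] assms]
    subbundle_fibre_subspace[OF vector_space_ER vector_bundle_subbundle[OF ER(1)] assms] .

lemma complex_combination:
  assumes "x \<in> mcarrier X" "(x, a) \<in> total ER" "(x, b) \<in> total ER"
  shows "(x, scal E \<i> b) \<in> total E" "(x, a + scal E \<i> b) \<in> total E"
proof -
  have mem: "a \<in> total E `` {x}" "b \<in> total E `` {x}"
    using assms(2,3) total_ER by auto
  have ib: "scal E \<i> b \<in> total E `` {x}"
    by (rule E.subspace_scale[OF fibre_subspace(1)[OF assms(1)] mem(2)])
  have "a + scal E \<i> b \<in> total E `` {x}"
    by (rule E.subspace_add[OF fibre_subspace(1)[OF assms(1)] mem(1) ib])
  with ib show "(x, scal E \<i> b) \<in> total E" "(x, a + scal E \<i> b) \<in> total E"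
    by simp_all
qed

lemma decomp_exists:
  assumes "(x, e) \<in> total E"
  obtains a b where "(x, a) \<in> total ER" "(x, b) \<in> total ER" "e = a + scal E \<i> b"
  using bspec[OF decomp assms] by auto

lemma real_form_fibre:
  assumes x: "x \<in> mcarrier X"
  shows "real_form (scal E) (total ER `` {x})"
proof (intro real_form.intro real_form_axioms.intro vector_space_E)
  show "0 \<in> total ER `` {x}"
    by (rule ER.subspace_0[OF fibre_subspace(2)[OF x]])
  show "a + b \<in> total ER `` {x}" if "a \<in> total ER `` {x}" "b \<in> total ER `` {x}" for a b
    by (rule ER.subspace_add[OF fibre_subspace(2)[OF x] that])
  show "scal E (of_real c) a \<in> total ER `` {x}" if "a \<in> total ER `` {x}" for c a
    unfolding scal_ER[symmetric] by (rule ER.subspace_scale[OF fibre_subspace(2)[OF x] that])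
  fix a b a' b'
  assume R: "a \<in> total ER `` {x}" "b \<in> total ER `` {x}" "a' \<in> total ER `` {x}" "b' \<in> total ER `` {x}"
    and eq: "a + scal E \<i> b = a' + scal E \<i> b'"
  have "(x, a + scal E \<i> b) \<in> total E"
    using complex_combination(2)[OF x] R by simp
  from bspec[OF decomp this]
  have ex1: "\<exists>!p. (x, fst p) \<in> total ER \<and> (x, snd p) \<in> total ER \<and> a + scal E \<i> b = fst p + scal E \<i> (snd p)"
    by (simp only: case_prod_unfold fst_conv snd_conv)
  have "(a, b) = (a', b')"
    by (rule Uniq_D[OF conjunct2[OF iffD1[OF ex1_iff_ex_Uniq ex1]]]) (use R eq in simp_all)
  then show "a = a' \<and> b = b'"
    by simp
qed

lemma anchor_combination:
  assumes x: "x \<in> mcarrier X" and a: "(x, a) \<in> total ER" and b: "(x, b) \<in> total ER"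
  shows "anchor E x (a + scal E \<i> b) = cplx X x (anchor ER x a) + tscale \<i> (cplx X x (anchor ER x b))"
proof -
  have mem: "a \<in> total E `` {x}" "b \<in> total E `` {x}" "scal E \<i> b \<in> total E `` {x}"
    using a b total_ER complex_combination(1)[OF x a b] by auto
  have "anchor E x (a + scal E \<i> b) = anchor E x a + anchor E x (scal E \<i> b)"
    using E(2) x mem(1,3) unfolding anchor_map_def by blast
  also have "anchor E x (scal E \<i> b) = tscale \<i> (anchor E x b)"
    using E(2) x mem(2) unfolding anchor_map_def by blast
  finally show ?thesis
    by (simp only: anchor_ER[OF x a] anchor_ER[OF x b])
qed

lemma anchor_ER_tangent:
  assumes "x \<in> mcarrier X" "(x, a) \<in> total ER"
  shows "anchor ER x a \<in> tangent_space X x"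
  using ER(2) assms unfolding anchor_map_def by blast

lemma anchor_ER_add:
  assumes "x \<in> mcarrier X" "(x, a) \<in> total ER" "(x, b) \<in> total ER"
  shows "anchor ER x (a + b) = anchor ER x a + anchor ER x b"
  using ER(2) assms unfolding anchor_map_def by blast

lemma anchor_ER_scal:
  assumes "x \<in> mcarrier X" "(x, a) \<in> total ER"
  shows "anchor ER x (scal ER c a) = tscale c (anchor ER x a)"
  using ER(2) assms unfolding anchor_map_def by blast

lemma anchor_ER_0:
  assumes "x \<in> mcarrier X"
  shows "anchor ER x 0 = 0"
proof -
  have "(x, 0) \<in> total ER"
    using ER.subspace_0[OF fibre_subspace(2)[OF assms]] by simp
  from anchor_ER_scal[OF assms this, of 0] show ?thesis
    by (simp only: ER.scale_zero_left tvec.scale_zero_left)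
qed

text \<open>The bridge from geometry to the model space: lying over T01 becomes the graph equation
  of \<open>chern_fibre\<close>.\<close>

lemma anchor_T01_iff:
  assumes "x \<in> mcarrier X" "(x, a) \<in> total ER" "(x, b) \<in> total ER" and "(U, \<phi>) \<in> atlas X" "x \<in> U"
  shows "anchor E x (a + scal E \<i> b) \<in> T01 X J x \<longleftrightarrow>
    chart_coords \<phi> (anchor ER x b) = J (chart_coords \<phi> (anchor ER x a))"
  unfolding anchor_combination[OF assms(1-3)]
  by (rule T01_iff[OF complex_manifold assms(4,5)]) (rule anchor_ER_tangent assms(1-3))+

lemma chart_anchor_eq_0_iff:
  assumes "x \<in> mcarrier X" "(x, a) \<in> total ER" "(U, \<phi>) \<in> atlas X" "x \<in> U"
  shows "chart_coords \<phi> (anchor ER x a) = 0 \<longleftrightarrow> anchor ER x a = 0"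
proof
  assume "chart_coords \<phi> (anchor ER x a) = 0"
  then have "chart_coords \<phi> (anchor ER x a) = chart_coords \<phi> 0"
    by (simp only: chart_coords_0)
  then show "anchor ER x a = 0"
    by (rule inj_onD[OF chart_coords_inj[OF smooth_manifold assms(3,4)]])
      (rule anchor_ER_tangent[OF assms(1,2)] tvec.subspace_0[OF tangent_space_subspace])+
qed (simp only: chart_coords_0)

text \<open>Bijectivity of the anchor from \<open>L\<close> to \<open>T01\<close> supplies the
  graph, injectivity and surjectivity conditions.\<close>

lemma chern_fibre_at:
  assumes L: "lifting X J E L" and x: "x \<in> mcarrier X" and chart: "(U, \<phi>) \<in> atlas X" "x \<in> U"
  shows "chern_fibre (scal E) (total ER `` {x}) (L `` {x}) (\<lambda>a. chart_coords \<phi> (anchor ER x a)) (mmodel X) J"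
proof -
  interpret real_form "scal E" "total ER `` {x}"
    by (rule real_form_fibre[OF x])
  obtain r where r: "subbundle X E L r"
    using L unfolding lifting_def by blast
  have bij: "bij_betw (anchor E x) (L `` {x}) (T01 X J x)"
    using L x unfolding lifting_def by blast
  have J0: "J 0 = 0" and J: "\<And>v. v \<in> mmodel X \<Longrightarrow> J v \<in> mmodel X"
    using complex_manifold by (auto simp: complex_manifold_def linear_0)
  have LE: "(x, e) \<in> total E" if "e \<in> L `` {x}" for e
    using r that unfolding subbundle_def by blast
  have graph: "chart_coords \<phi> (anchor ER x b) = J (chart_coords \<phi> (anchor ER x a))"
    if "a \<in> total ER `` {x}" "b \<in> total ER `` {x}" "a + scal E \<i> b \<in> L `` {x}" for a b
    using anchor_T01_iff[OF x _ _ chart, of a b] that bij_betwE[OF bij] by blast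
  show ?thesis
  proof unfold_locales
    show sub: "E.subspace (L `` {x})"
      by (rule subbundle_fibre_subspace[OF vector_space_E r x])
    show "\<exists>a\<in>total ER `` {x}. \<exists>b\<in>total ER `` {x}. e = a + scal E \<i> b" if "e \<in> L `` {x}" for e
      using decomp_exists[OF LE[OF that]] by blast
    show "chart_coords \<phi> (anchor ER x (a + b)) = chart_coords \<phi> (anchor ER x a) + chart_coords \<phi> (anchor ER x b)"
      if "a \<in> total ER `` {x}" "b \<in> total ER `` {x}" for a b
      using that by (simp only: Image_singleton_iff anchor_ER_add[OF x] chart_coords_add)
    show "chart_coords \<phi> (anchor ER x (scal E (of_real c) a)) = c *\<^sub>R chart_coords \<phi> (anchor ER x a)"
      if "a \<in> total ER `` {x}" for c a
      using that by (simp only: Image_singleton_iff scal_ER[symmetric] anchor_ER_scal[OF x] chart_coords_tscale)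
    show "chart_coords \<phi> (anchor ER x a) \<in> mmodel X" if "a \<in> total ER `` {x}" for a
      by (rule chart_coords_in_model[OF smooth_manifold chart anchor_ER_tangent[OF x]]) (use that in simp)
    show "chart_coords \<phi> (anchor ER x b) = J (chart_coords \<phi> (anchor ER x a))"
      if "a \<in> total ER `` {x}" "b \<in> total ER `` {x}" "a + scal E \<i> b \<in> L `` {x}" for a b
      by (rule graph[OF that])
    show "a = 0 \<and> b = 0"
      if ab: "a \<in> total ER `` {x}" "b \<in> total ER `` {x}" "a + scal E \<i> b \<in> L `` {x}"
        and 0: "chart_coords \<phi> (anchor ER x a) = 0" for a b
    proof -
      have mem: "(x, a) \<in> total ER" "(x, b) \<in> total ER" "(x, 0) \<in> total ER"
        using ab(1,2) R_0 by simp_all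
      have "chart_coords \<phi> (anchor ER x b) = 0"
        using graph[OF ab] 0 J0 by simp
      then have "anchor ER x a = anchor ER x 0" "anchor ER x b = anchor ER x 0"
        using 0 chart_anchor_eq_0_iff[OF x mem(1) chart] chart_anchor_eq_0_iff[OF x mem(2) chart]
          anchor_ER_0[OF x] by (simp_all only:)
      \<comment> \<open>Once the real anchors of \<open>a\<close> and \<open>b\<close> vanish, the
        element of \<open>L\<close> has the same anchor as the zero vector written as 0 + \<i> 0;
        injectivity on \<open>L\<close> and uniqueness of real and imaginary parts finish.\<close>
      then have "anchor E x (a + scal E \<i> b) = anchor E x (0 + scal E \<i> 0)"
        by (simp only: anchor_combination[OF x mem(1,2)] anchor_combination[OF x mem(3,3)])
      moreover have "0 + scal E \<i> 0 \<in> L `` {x}"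
        using E.subspace_0[OF sub] by (simp only: E.scale_zero_right add_0_left)
      ultimately have "a + scal E \<i> b = 0 + scal E \<i> 0"
        using inj_onD[OF bij_betw_imp_inj_on[OF bij]] ab(3) by blast
      from R_unique[OF ab(1,2) R_0 R_0 this] show ?thesis .
    qed
    show "\<exists>a\<in>total ER `` {x}. \<exists>b\<in>total ER `` {x}. a + scal E \<i> b \<in> L `` {x} \<and> chart_coords \<phi> (anchor ER x a) = v"
      if v: "v \<in> mmodel X" for v
    proof -
      \<comment> \<open>Tangent vectors with coordinates \<open>v\<close> and \<open>J v\<close>
        combine to a (0,1)-vector. Its preimage in \<open>L\<close> has a real part with anchor
        \<open>u\<close>.\<close>
      obtain u where u: "u \<in> tangent_space X x" "chart_coords \<phi> u = v"
        by (rule chart_coords_surj[OF smooth_manifold chart v])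
      obtain w where w: "w \<in> tangent_space X x" "chart_coords \<phi> w = J v"
        by (rule chart_coords_surj[OF smooth_manifold chart J[OF v]])
      have "cplx X x u + tscale \<i> (cplx X x w) \<in> T01 X J x"
        using T01_iff[OF complex_manifold chart u(1) w(1)] u(2) w(2) by simp
      then obtain e where e: "e \<in> L `` {x}" "anchor E x e = cplx X x u + tscale \<i> (cplx X x w)"
        using bij_betw_imp_surj_on[OF bij] by (metis imageE)
      obtain a b where ab: "(x, a) \<in> total ER" "(x, b) \<in> total ER" "e = a + scal E \<i> b"
        by (rule decomp_exists[OF LE[OF e(1)]])
      have "cplx X x (anchor ER x a) + tscale \<i> (cplx X x (anchor ER x b)) = cplx X x u + tscale \<i> (cplx X x w)"
        using anchor_combination[OF x ab(1,2)] e(2) ab(3) by simp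
      from cplx_add_i_inj[OF this anchor_ER_tangent[OF x ab(1)] anchor_ER_tangent[OF x ab(2)] u(1) w(1)]
      have "anchor ER x a = u" by blast
      then show ?thesis
        using ab e(1) u(2) by (intro bexI[of _ a] bexI[of _ b]) auto
    qed
  qed
qed

section \<open>The bundle of real parts and its uniqueness\<close>

definition real_parts :: "('x \<times> 'v) set \<Rightarrow> ('x \<times> 'v) set" where
  "real_parts L = {(x, a). x \<in> mcarrier X \<and> (x, a) \<in> total ER \<and> (\<exists>b. (x, b) \<in> total ER \<and> (x, a + scal E \<i> b) \<in> L)}"

lemma real_parts_fibre:
  assumes "x \<in> mcarrier X"
  shows "real_parts L `` {x} = real_form.re_part (scal E) (total ER `` {x}) (L `` {x})"
  unfolding real_form.re_part_def[OF real_form_fibre[OF assms]] using assms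
  by (auto simp: real_parts_def)

lemma chart_at:
  assumes "x \<in> mcarrier X"
  obtains U \<phi> where "(U, \<phi>) \<in> atlas X" "x \<in> U"
  using assms smooth_manifold unfolding smooth_manifold_def by blast

text \<open>The fibrewise frames of \<open>re_part_frame\<close> are assembled from a local frame of
  \<open>L\<close>; smoothness comes from the comparison of sections of \<open>E\<close> and
  \<open>ER\<close>, the rank from a chart at a point.\<close>

lemma subbundle_real_parts:
  assumes L: "lifting X J E L"
  shows "subbundle X ER (real_parts L) (dim (mmodel X))"
proof -
  obtain r where r: "subbundle X E L r"
    using L unfolding lifting_def by blast
  have "\<exists>U f. openin (mtop X) U \<and> x \<in> U \<and> frame_on ER (real_parts L) (dim (mmodel X)) U f \<and>
      (\<forall>k<dim (mmodel X). smooth_section X ER U (f k))" if x: "x \<in> mcarrier X" for x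
  proof -
    obtain U e where U: "openin (mtop X) U" "x \<in> U" "frame_on E L r U e"
      and e: "\<And>i. i < r \<Longrightarrow> smooth_section X E U (e i)"
      using r x unfolding subbundle_def by meson
    have UX: "y \<in> mcarrier X" if "y \<in> U" for y
      using that openin_subset[OF U(1)] by blast
    have "\<exists>p. (y, fst p) \<in> total ER \<and> (y, snd p) \<in> total ER \<and> e i y = fst p + scal E \<i> (snd p)"
      if "y \<in> U" "i < r" for y i
    proof -
      have "(y, e i y) \<in> total E"
        using e[OF that(2)] that(1) unfolding smooth_section_def by blast
      then show ?thesis
        by (rule decomp_exists) (metis fst_conv snd_conv)
    qed
    \<comment> \<open>The decomposition is chosen pointwise. Smoothness of the chosen parts follows
      afterwards, because their combination is the smooth section \<open>e i\<close>.\<close>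
    then obtain p where p: "(y, fst (p y i)) \<in> total ER" "(y, snd (p y i)) \<in> total ER"
      "e i y = fst (p y i) + scal E \<i> (snd (p y i))" if "y \<in> U" "i < r" for y i
      by metis
    define a where "a i y = fst (p y i)" for i y
    define b where "b i y = snd (p y i)" for i y
    have ab: "a i y \<in> total ER `` {y}" "b i y \<in> total ER `` {y}" "e i y = a i y + scal E \<i> (b i y)"
      if "y \<in> U" "i < r" for y i
      using p that by (simp_all add: a_def b_def)
    have smooth: "smooth_section X ER U (a i) \<and> smooth_section X ER U (b i)" if "i < r" for i
    proof -
      have "smooth_section X E U (\<lambda>y. a i y + scal E \<i> (b i y))"
        by (rule smooth_section_cong[OF e[OF that] ab(3)[OF _ that]])
      then show ?thesis
        using smooth_section_iff[OF U(1), of "a i" "b i"] ab(1,2) that by simp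
    qed
    define f where "f k = (if k < r then a k else b (k - r))" for k
    have frame: "inj_on (\<lambda>k. f k y) {..<2 * r}" "\<not> ER.dependent ((\<lambda>k. f k y) ` {..<2 * r})"
        "ER.span ((\<lambda>k. f k y) ` {..<2 * r}) = real_parts L `` {y}" and dim: "dim (mmodel X) = 2 * r"
      if y: "y \<in> U" for y
    proof -
      obtain V \<psi> where chart: "(V, \<psi>) \<in> atlas X" "y \<in> V"
        using chart_at[OF UX[OF y]] by blast
      interpret chern_fibre "scal E" "total ER `` {y}" "L `` {y}" "\<lambda>a. chart_coords \<psi> (anchor ER y a)" "mmodel X" J
        by (rule chern_fibre_at[OF L UX[OF y] chart])
      have scal: "scal ER = (\<lambda>c. scal E (complex_of_real c))"
        by (simp add: fun_eq_iff scal_ER)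
      have e_eq: "(\<lambda>i. e i y) ` {..<r} = (\<lambda>i. a i y + scal E \<i> (b i y)) ` {..<r}"
        using ab(3)[OF y] by (intro image_cong) auto
      have fy: "(\<lambda>k. f k y) = (\<lambda>k. if k < r then a k y else b (k - r) y)"
        by (simp add: fun_eq_iff f_def)
      have "inj_on (\<lambda>i. e i y) {..<r}"
        using U(3) y unfolding frame_on_def by blast
      moreover have "inj_on (\<lambda>i. e i y) {..<r} \<longleftrightarrow> inj_on (\<lambda>i. a i y + scal E \<i> (b i y)) {..<r}"
        by (rule inj_on_cong) (simp only: lessThan_iff ab(3)[OF y])
      ultimately have inj: "inj_on (\<lambda>i. a i y + scal E \<i> (b i y)) {..<r}"
        by blast
      have "\<not> E.dependent ((\<lambda>i. e i y) ` {..<r})" "E.span ((\<lambda>i. e i y) ` {..<r}) = L `` {y}"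
        using U(3) y unfolding frame_on_def by blast+
      note frame' = re_part_frame[OF ab(1,2)[OF y] inj this[unfolded e_eq] im_eq_0, folded fy]
      show fr: "inj_on (\<lambda>k. f k y) {..<2 * r}" "\<not> ER.dependent ((\<lambda>k. f k y) ` {..<2 * r})"
        "ER.span ((\<lambda>k. f k y) ` {..<2 * r}) = real_parts L `` {y}"
        unfolding real_parts_fibre[OF UX[OF y]] scal using frame' by blast+
      \<comment> \<open>The anchor in the chart maps the real parts isomorphically onto the model
        space. The chart may vary with \<open>y\<close>, but the model space does not.\<close>
      show "dim (mmodel X) = 2 * r"
      proof (rule dim_eq_of_frame[OF vector_space_ER fr(1,2) fr(3)[unfolded real_parts_fibre[OF UX[OF y]]]])
        show "chart_coords \<psi> (anchor ER y (v + w)) = chart_coords \<psi> (anchor ER y v) + chart_coords \<psi> (anchor ER y w)"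
          if "v \<in> re_part (L `` {y})" "w \<in> re_part (L `` {y})" for v w
          using that by (intro T_add) (simp_all add: re_part_def)
        show "chart_coords \<psi> (anchor ER y (scal ER c v)) = c *\<^sub>R chart_coords \<psi> (anchor ER y v)"
          if "v \<in> re_part (L `` {y})" for c v
          unfolding scal_ER using that by (intro T_scale) (simp add: re_part_def)
        show "(\<lambda>a. chart_coords \<psi> (anchor ER y a)) ` re_part (L `` {y}) = mmodel X"
          by (rule T_image_re_part)
        show "v = 0" if "v \<in> re_part (L `` {y})" "chart_coords \<psi> (anchor ER y v) = 0" for v
          by (rule re_part_inj[OF that])
      qed
    qed
    have "frame_on ER (real_parts L) (2 * r) U f"
      unfolding frame_on_def using frame by blast
    moreover have "smooth_section X ER U (f k)" if "k < 2 * r" for k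
      using smooth[of k] smooth[of "k - r"] that by (cases "k < r") (auto simp: f_def)
    ultimately show ?thesis
      using U(1,2) dim[OF U(2)] by metis
  qed
  moreover have "real_parts L \<subseteq> total ER"
    by (auto simp: real_parts_def)
  ultimately show ?thesis
    unfolding subbundle_def by blast
qed

lemma horizontal_lift_real_parts:
  assumes L: "lifting X J E L"
  shows "horizontal_lift X ER (real_parts L)"
  unfolding horizontal_lift_def
proof (intro conjI ballI subbundle_real_parts[OF L])
  fix x assume x: "x \<in> mcarrier X"
  obtain U \<phi> where chart: "(U, \<phi>) \<in> atlas X" "x \<in> U"
    using chart_at[OF x] by blast
  interpret chern_fibre "scal E" "total ER `` {x}" "L `` {x}" "\<lambda>a. chart_coords \<phi> (anchor ER x a)" "mmodel X" J
    by (rule chern_fibre_at[OF L x chart])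
  have "0 \<in> real_parts L `` {x}"
    unfolding real_parts_fibre[OF x] by (rule real.subspace_0[OF re_part_subspace[OF L_subspace]])
  moreover have "0 \<in> anchor_kernel ER x"
    using R_0 anchor_ER_0[OF x] unfolding anchor_kernel_def by blast
  moreover have "a = 0" if "a \<in> real_parts L `` {x}" "a \<in> anchor_kernel ER x" for a
  proof (rule re_part_inj)
    show "a \<in> re_part (L `` {x})"
      using that(1) unfolding real_parts_fibre[OF x] .
    show "chart_coords \<phi> (anchor ER x a) = 0"
      using that(2) unfolding anchor_kernel_def by (simp only: mem_Collect_eq chart_coords_0)
  qed
  ultimately show "real_parts L `` {x} \<inter> anchor_kernel ER x = {0}"
    by blast
qed

lemma lifting_eq_real_parts:
  assumes L: "lifting X J E L"
  shows "L = {(x, e). (x, e) \<in> complexification E (real_parts L) \<and> anchor E x e \<in> T01 X J x}"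
proof -
  have "(x, e) \<in> L \<longleftrightarrow> (x, e) \<in> complexification E (real_parts L) \<and> anchor E x e \<in> T01 X J x" for x e
  proof (cases "x \<in> mcarrier X")
    case x: True
    obtain U \<phi> where chart: "(U, \<phi>) \<in> atlas X" "x \<in> U"
      using chart_at[OF x] by blast
    interpret chern_fibre "scal E" "total ER `` {x}" "L `` {x}" "\<lambda>a. chart_coords \<phi> (anchor ER x a)" "mmodel X" J
      by (rule chern_fibre_at[OF L x chart])
    have mem: "(x, a) \<in> real_parts L \<longleftrightarrow> a \<in> re_part (L `` {x})" for a
      using real_parts_fibre[OF x, of L] by blast
    have R: "(x, a) \<in> total ER" if "a \<in> re_part (L `` {x})" for a
      using that by (simp add: re_part_def)
    have "(x, e) \<in> L \<longleftrightarrow> (\<exists>a b. e = a + scal E \<i> b \<and> a \<in> re_part (L `` {x}) \<and> b \<in> re_part (L `` {x}) \<and>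
        chart_coords \<phi> (anchor ER x b) = J (chart_coords \<phi> (anchor ER x a)))"
      using L_eq_re_part by blast
    also have "\<dots> \<longleftrightarrow> (\<exists>a b. e = a + scal E \<i> b \<and> a \<in> re_part (L `` {x}) \<and> b \<in> re_part (L `` {x}) \<and>
        anchor E x e \<in> T01 X J x)"
      using anchor_T01_iff[OF x R R chart] by metis
    also have "\<dots> \<longleftrightarrow> (x, e) \<in> complexification E (real_parts L) \<and> anchor E x e \<in> T01 X J x"
      unfolding complexification_def by (auto simp: mem)
    finally show ?thesis .
  next
    \<comment> \<open>The equality concerns all pairs, so points off the manifold count as well:
      there both sides are empty.\<close>
    case False
    obtain r where "subbundle X E L r"
      using L unfolding lifting_def by blast
    then have "L \<subseteq> total E"
      by (simp add: subbundle_def)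
    also have "total E \<subseteq> mcarrier X \<times> UNIV"
      using E(1) by (simp add: vector_bundle_def)
    finally show ?thesis
      using False by (auto simp: complexification_def real_parts_def)
  qed
  then show ?thesis
    by auto
qed

lemma horizontal_lift_unique:
  assumes L: "lifting X J E L" and W: "horizontal_lift X ER W"
    and eq: "L = {(x, e). (x, e) \<in> complexification E W \<and> anchor E x e \<in> T01 X J x}"
  shows "W = real_parts L"
proof -
  have sub: "subbundle X ER W (dim (mmodel X))"
    and ker: "\<And>x. x \<in> mcarrier X \<Longrightarrow> W `` {x} \<inter> anchor_kernel ER x = {0}"
    using W unfolding horizontal_lift_def by blast+
  have W_total: "W \<subseteq> total ER"
    using sub unfolding subbundle_def by blast
  have "W `` {x} = real_parts L `` {x}" if x: "x \<in> mcarrier X" for x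
  proof -
    obtain U \<phi> where chart: "(U, \<phi>) \<in> atlas X" "x \<in> U"
      using chart_at[OF x] by blast
    interpret chern_fibre "scal E" "total ER `` {x}" "L `` {x}" "\<lambda>a. chart_coords \<phi> (anchor ER x a)" "mmodel X" J
      by (rule chern_fibre_at[OF L x chart])
    show ?thesis
      unfolding real_parts_fibre[OF x]
    proof (rule re_part_unique)
      show "W `` {x} \<subseteq> total ER `` {x}"
        using W_total by blast
      show "a - b \<in> W `` {x}" if "a \<in> W `` {x}" "b \<in> W `` {x}" for a b
        by (rule ER.subspace_diff[OF subbundle_fibre_subspace[OF vector_space_ER sub x] that])
      show "a = 0" if "a \<in> W `` {x}" "chart_coords \<phi> (anchor ER x a) = 0" for a
      proof -
        have a: "(x, a) \<in> total ER"
          using that(1) W_total by blast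
        have "anchor ER x a = 0"
          using chart_anchor_eq_0_iff[OF x a chart] that(2) by blast
        then show ?thesis
          using ker[OF x] that(1) a unfolding anchor_kernel_def by blast
      qed
      show "L `` {x} \<subseteq> {a + scal E \<i> b | a b. a \<in> W `` {x} \<and> b \<in> W `` {x}}"
        by (subst eq) (auto simp: complexification_def)
    qed
  qed
  \<comment> \<open>Fibres off the manifold are empty for both sets, so agreement over the manifold
    gives equality of the total spaces.\<close>
  moreover have "fst p \<in> mcarrier X" if "p \<in> W \<or> p \<in> real_parts L" for p
    using that W_total ER(1) unfolding vector_bundle_def real_parts_def by auto
  ultimately show ?thesis
    by fastforce
qed

theorem chern_correspondence:
  assumes "lifting X J E L"
  shows "\<exists>!W. horizontal_lift X ER W \<and>
    L = {(x, e). (x, e) \<in> complexification E W \<and> anchor E x e \<in> T01 X J x}"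
  using horizontal_lift_real_parts[OF assms] lifting_eq_real_parts[OF assms] horizontal_lift_unique[OF assms]
  by blast

end

theorem lemma4p11:
  fixes X :: "('x, 'a::euclidean_space) manifold" and JX :: "'a \<Rightarrow> 'a"
    and G :: "'g monoid" and GM :: "('g, 'h::euclidean_space) manifold" and JG :: "'h \<Rightarrow> 'h"
    and K :: "'g set" and KM :: "('g, 'l::euclidean_space) manifold"
    and B :: "('g, real) tvec \<Rightarrow> ('g, real) tvec \<Rightarrow> complex"
    and P :: "('p, 'b::euclidean_space) manifold" and q :: "'p \<Rightarrow> 'x" and act :: "'p \<Rightarrow> 'g \<Rightarrow> 'p"
    and E :: "('x, 'v::ab_group_add, complex) courant"
    and \<rho> :: "'x \<Rightarrow> 'v \<Rightarrow> ('p \<Rightarrow> ('p, complex) tvec) set"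
    and L :: "('x \<times> 'v) set"
    and PR :: "('p, 'c::euclidean_space) manifold"
    and ER :: "('x, 'v, real) courant" and \<rho>R :: "'x \<Rightarrow> 'v \<Rightarrow> 'p \<Rightarrow> ('p, real) tvec"
  assumes "complex_manifold X JX"
    and "complex_reductive G GM JG K KM"
    and "invariant_form G GM JG B" and "real_on_subgroup G GM KM B"
    and "complex_string_algebroid X G GM JG B P q act E \<rho>"
    and "lifting X JX E L"
    and "compact_form X G GM K KM B P q act E \<rho> PR ER \<rho>R"
  shows "\<exists>!W. horizontal_lift X ER W \<and>
    L = {(x, e). (x, e) \<in> complexification E W \<and> anchor E x e \<in> T01 X JX x}"
proof -
  have "courant_algebroid X E"
    using assms(5) unfolding complex_string_algebroid_def by (elim conjE)
  moreover have "courant_algebroid X ER"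
    using assms(7) unfolding compact_form_def real_string_algebroid_def by (elim conjE)
  ultimately have alg: "vector_bundle X E" "anchor_map X E" "vector_bundle X ER" "anchor_map X ER"
    by (simp_all only: courant_algebroid_def)
  note form = assms(7)[unfolded compact_form_def]
  interpret real_courant_form X JX E ER
  proof (unfold_locales, goal_cases)
    case 1 show ?case by (rule assms(1))
  next
    case 2 show ?case by (rule alg)
  next
    case 3 show ?case by (rule alg)
  next
    case 4 show ?case by (rule alg)
  next
    case 5 show ?case by (rule alg)
  next
    case 6 show ?case using form by (simp only:)
  next
    case (7 c v) show ?case using form by (simp only:)
  next
    case 8 show ?case using form by (elim conjE)
  next
    case (9 U a b) then show ?case using form by (simp only:)
  next
    case (10 x v) then show ?case using form by blast
  qed
  show ?thesis
    by (rule chern_correspondence[OF assms(6)])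
qed

end
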